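(* Let $\vec G$ be a connected digraph on a linearly ordered edge set $E$, bipolar with respect to $p=\min(E)$, and let $\omega=\max(E)$. Then: (a) if $|E|=1$, then $\alpha(\vec G)=\{\omega\}$; and if $|E|>1$: (b) if $\vec G/\omega$ is bipolar w.r.t. $p$ but $\vec G\setminus\omega$ is not, then $\alpha(\vec G)=\alpha(\vec G/\omega)\cup\{\omega\}$; (c) if $\vec G\setminus\omega$ is bipolar w.r.t. $p$ but $\vec G/\omega$ is not, then $\alpha(\vec G)=\alpha(\vec G\setminus\omega)$; (d) if both $\vec G\setminus\omega$ and $\vec G/\omega$ are bipolar w.r.t. $p$, let $T'=\alpha(\vec G\setminus\omega)$, $C=C_{\vec G}(T';\omega)$ and $e=\min(C)$; if $e$ and $\omega$ have opposite signs in $C$ then $\alpha(\vec G)=\alpha(\vec G\setminus\omega)$, and if they have the same sign then $\alpha(\vec G)=\alpha(\vec G/\omega)\cup\{\omega\}$; (e) equivalently in case (d), letting $T''=\alpha(\vec G/\omega)$, $D=C^*_{\vec G}(T''\cup\{\omega\};\omega)$ and $e=\min(D)$: if $e$ and $\omega$ have opposite signs in $D$ then $\alpha(\vec G)=\alpha(\vec G/\omega)\cup\{\omega\}$, and if they have the same sign then $\alpha(\vec G)=\alpha(\vec G\setminus\omega)$.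
   Context: Graphs are finite and connected, loops and multiple edges allowed; cycles and cocycles (inclusion-minimal nonempty edge cuts) are edge subsets. For a spanning tree $T$ and $t\in T$, $C^*(T;t)$ denotes the unique cocycle contained in $(E\setminus T)\cup\{t\}$; for $e\notin T$, $C(T;e)$ denotes the unique cycle contained in $T\cup\{e\}$. In a digraph, a cycle gives two opposite signed cycles (fix a traversal direction; forward edges positive, backward negative), and a cocycle between vertex sides $(X,V\setminus X)$ gives two opposite signed cocycles (edges from $X$ to $V\setminus X$ positive, others negative). Fundamental cycles $C(T;e)$ (resp. cocycles $C^*(T;t)$) are signed so that $e$ (resp. $t$) is positive. $\vec G/\omega$ and $\vec G\setminus\omega$ denote contraction and deletion of $\omega$, with inherited orientations and order. A digraph with edge set $E$ is bipolar w.r.t. $p\in E$ if it is acyclic and has a unique source and a unique sink, which are the endpoints of $p$ (a single isthmus edge $p$ is bipolar w.r.t. $p$). For $\vec G$ on a linearly ordered edge set $E$, bipolar w.r.t. $p=\min(E)$, the fully optimal spanning tree $\alpha(\vec G)$ is the unique spanning tree $T$ such that for all $b\in T\setminus\{p\}$, $b$ and $\min(C^*(T;b))$ have opposite signs in $C^*(T;b)$, and for all $e\in E\setminus T$, $e$ and $\min(C(T;e))$ have opposite signs in $C(T;e)$ (existence and uniqueness is a known theorem). *)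

theory Defs
  imports Main
begin

text \<open>Finite digraphs with loops and multiple edges: vertices of type 'v, edges of type 'e,
  each edge has a tail and a head. The linear order on edges is the type order of 'e.\<close>

record ('v, 'e) dg =
  verts :: "'v set"
  arcs  :: "'e set"
  tail  :: "'e \<Rightarrow> 'v"
  head  :: "'e \<Rightarrow> 'v"

definition wf_dg :: "('v, 'e) dg \<Rightarrow> bool" where
  "wf_dg G \<longleftrightarrow> finite (verts G) \<and> finite (arcs G) \<and>
     (\<forall>e\<in>arcs G. tail G e \<in> verts G \<and> head G e \<in> verts G)"

text \<open>Underlying undirected adjacency and (undirected) connectedness.\<close>

definition undir_rel :: "('v, 'e) dg \<Rightarrow> ('v \<times> 'v) set" where
  "undir_rel G = {(tail G e, head G e) | e. e \<in> arcs G} \<union> {(head G e, tail G e) | e. e \<in> arcs G}"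

definition connected :: "('v, 'e) dg \<Rightarrow> bool" where
  "connected G \<longleftrightarrow> (\<forall>u\<in>verts G. \<forall>v\<in>verts G. (u, v) \<in> (undir_rel G)\<^sup>*)"

text \<open>Directed arc relation; a digraph is acyclic iff it has no directed cycle.\<close>

definition arc_rel :: "('v, 'e) dg \<Rightarrow> ('v \<times> 'v) set" where
  "arc_rel G = {(tail G e, head G e) | e. e \<in> arcs G}"

definition is_source :: "('v, 'e) dg \<Rightarrow> 'v \<Rightarrow> bool" where
  "is_source G v \<longleftrightarrow> v \<in> verts G \<and> (\<forall>e\<in>arcs G. head G e \<noteq> v)"

definition is_sink :: "('v, 'e) dg \<Rightarrow> 'v \<Rightarrow> bool" where
  "is_sink G v \<longleftrightarrow> v \<in> verts G \<and> (\<forall>e\<in>arcs G. tail G e \<noteq> v)"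

text \<open>Bipolar w.r.t. p: (connected, per the standing convention) acyclic, unique source and
  unique sink, which are the endpoints of p (source = tail, sink = head).\<close>

definition bipolar :: "('v, 'e) dg \<Rightarrow> 'e \<Rightarrow> bool" where
  "bipolar G p \<longleftrightarrow> p \<in> arcs G \<and> connected G \<and> acyclic (arc_rel G) \<and>
     {v. is_source G v} = {tail G p} \<and> {v. is_sink G v} = {head G p}"

text \<open>Cycles, given by a traversal: edges es!i goes between vs!i and vs!((i+1) mod k),
  with distinct edges and distinct vertices (k = 1: a loop; k = 2: two parallel edges).
  Edge es!i is positive (forward) iff its tail is vs!i.\<close>

definition cycle_walk :: "('v, 'e) dg \<Rightarrow> 'e list \<Rightarrow> 'v list \<Rightarrow> bool" where
  "cycle_walk G es vs \<longleftrightarrow> es \<noteq> [] \<and> length vs = length es \<and> distinct es \<and> distinct vs \<and>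
     set es \<subseteq> arcs G \<and> set vs \<subseteq> verts G \<and>
     (\<forall>i<length es. {tail G (es ! i), head G (es ! i)} = {vs ! i, vs ! ((i + 1) mod length es)})"

definition is_cycle :: "('v, 'e) dg \<Rightarrow> 'e set \<Rightarrow> bool" where
  "is_cycle G C \<longleftrightarrow> (\<exists>es vs. cycle_walk G es vs \<and> set es = C)"

text \<open>e and f have opposite (resp. the same) signs in the cycle C.\<close>

definition cyc_opposite :: "('v, 'e) dg \<Rightarrow> 'e set \<Rightarrow> 'e \<Rightarrow> 'e \<Rightarrow> bool" where
  "cyc_opposite G C e f \<longleftrightarrow> (\<exists>es vs i j. cycle_walk G es vs \<and> set es = C \<and>
     i < length es \<and> j < length es \<and> es ! i = e \<and> es ! j = f \<and>
     (tail G e = vs ! i) \<noteq> (tail G f = vs ! j))"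

definition cyc_same :: "('v, 'e) dg \<Rightarrow> 'e set \<Rightarrow> 'e \<Rightarrow> 'e \<Rightarrow> bool" where
  "cyc_same G C e f \<longleftrightarrow> (\<exists>es vs i j. cycle_walk G es vs \<and> set es = C \<and>
     i < length es \<and> j < length es \<and> es ! i = e \<and> es ! j = f \<and>
     (tail G e = vs ! i) = (tail G f = vs ! j))"

text \<open>Edge cuts and cocycles (inclusion-minimal nonempty edge cuts). In the cut between
  (X, V - X), edges from X to V - X are positive.\<close>

definition cut :: "('v, 'e) dg \<Rightarrow> 'v set \<Rightarrow> 'e set" where
  "cut G X = {e \<in> arcs G. (tail G e \<in> X) \<noteq> (head G e \<in> X)}"

definition is_cut :: "('v, 'e) dg \<Rightarrow> 'e set \<Rightarrow> bool" where
  "is_cut G D \<longleftrightarrow> (\<exists>X \<subseteq> verts G. cut G X = D)"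

definition is_cocycle :: "('v, 'e) dg \<Rightarrow> 'e set \<Rightarrow> bool" where
  "is_cocycle G D \<longleftrightarrow> D \<noteq> {} \<and> is_cut G D \<and>
     (\<forall>D'. D' \<noteq> {} \<and> is_cut G D' \<and> D' \<subseteq> D \<longrightarrow> D' = D)"

definition cocyc_opposite :: "('v, 'e) dg \<Rightarrow> 'e set \<Rightarrow> 'e \<Rightarrow> 'e \<Rightarrow> bool" where
  "cocyc_opposite G D e f \<longleftrightarrow> e \<in> D \<and> f \<in> D \<and>
     (\<exists>X \<subseteq> verts G. cut G X = D \<and> (tail G e \<in> X) \<noteq> (tail G f \<in> X))"

definition cocyc_same :: "('v, 'e) dg \<Rightarrow> 'e set \<Rightarrow> 'e \<Rightarrow> 'e \<Rightarrow> bool" where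
  "cocyc_same G D e f \<longleftrightarrow> e \<in> D \<and> f \<in> D \<and>
     (\<exists>X \<subseteq> verts G. cut G X = D \<and> (tail G e \<in> X) = (tail G f \<in> X))"

text \<open>Spanning trees (connected spanning subgraphs without cycles) and fundamental
  cycles / cocycles.\<close>

definition spanning_tree :: "('v, 'e) dg \<Rightarrow> 'e set \<Rightarrow> bool" where
  "spanning_tree G T \<longleftrightarrow> T \<subseteq> arcs G \<and> connected (G\<lparr>arcs := T\<rparr>) \<and>
     \<not> (\<exists>C. is_cycle G C \<and> C \<subseteq> T)"

definition fund_cycle :: "('v, 'e) dg \<Rightarrow> 'e set \<Rightarrow> 'e \<Rightarrow> 'e set" where
  "fund_cycle G T e = (THE C. is_cycle G C \<and> C \<subseteq> insert e T)"

definition fund_cocycle :: "('v, 'e) dg \<Rightarrow> 'e set \<Rightarrow> 'e \<Rightarrow> 'e set" where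
  "fund_cocycle G T t = (THE D. is_cocycle G D \<and> D \<subseteq> insert t (arcs G - T))"

text \<open>Fully optimal spanning tree of a digraph bipolar w.r.t. p = min E.
  Fundamental cycles/cocycles are signed so that e resp. b is positive; only relative signs matter.\<close>

definition alpha :: "('v, 'e::linorder) dg \<Rightarrow> 'e set" where
  "alpha G = (THE T. spanning_tree G T \<and>
     (\<forall>b \<in> T - {Min (arcs G)}. cocyc_opposite G (fund_cocycle G T b) b (Min (fund_cocycle G T b))) \<and>
     (\<forall>e \<in> arcs G - T. cyc_opposite G (fund_cycle G T e) e (Min (fund_cycle G T e))))"

text \<open>Deletion and contraction of an edge w (contraction identifies head w with tail w).\<close>

definition del_edge :: "('v, 'e) dg \<Rightarrow> 'e \<Rightarrow> ('v, 'e) dg" where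
  "del_edge G w = G\<lparr>arcs := arcs G - {w}\<rparr>"

definition merge_vtx :: "('v, 'e) dg \<Rightarrow> 'e \<Rightarrow> 'v \<Rightarrow> 'v" where
  "merge_vtx G w v = (if v = head G w then tail G w else v)"

definition contr_edge :: "('v, 'e) dg \<Rightarrow> 'e \<Rightarrow> ('v, 'e) dg" where
  "contr_edge G w = G\<lparr>verts := merge_vtx G w ` verts G, arcs := arcs G - {w},
      tail := merge_vtx G w \<circ> tail G, head := merge_vtx G w \<circ> head G\<rparr>"

end

theory Submission
  imports Defs
begin

text \<open>Write \<open>x\<close> for the combination of the fundamental cocycles of a fully optimal tree \<open>T\<close> and
  \<open>y\<close> for the combination of its fundamental cycles, both with weights \<open>w\<close> decreasing so fast along
  the edge order that the smallest edge of each fundamental cycle or cocycle decides all signs.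
  The optimality criterion then says exactly that \<open>x \<ge> w\<close>, with equality precisely on \<open>T\<close>, and that
  \<open>y \<ge> w\<close> away from \<open>p\<close>, with equality precisely off \<open>T\<close>. Orthogonality of tensions and
  flows yields that two such trees coincide (complementary slackness), and positivity of \<open>x\<close> and \<open>y\<close>
  yields that a digraph with a fully optimal tree is bipolar.

  Optimality at all edges except \<open>\<omega>\<close> passes between \<open>G\<close> and its minors at \<open>\<omega>\<close> and does not depend on the
  orientation of \<open>\<omega>\<close>, whereas reversing \<open>\<omega>\<close> repairs a failure at \<open>\<omega>\<close>. If a fully optimal tree of a
  minor did not lift to \<open>G\<close>, it would therefore lift to \<open>G\<close> with \<open>\<omega>\<close> reversed, which is then bipolar;
  this forces both minors to be bipolar, and uniqueness in the reversed digraph shows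
  that one of the two candidate trees is fully optimal in \<open>G\<close>.\<close>

section \<open>Cuts, potentials and bipolarity\<close>

text \<open>The tension (coboundary) of an integer potential. Cuts are the case of an indicator
  potential, so signed cuts can be added and scaled like integer vectors.\<close>

definition delta :: "('v, 'e) dg \<Rightarrow> ('v \<Rightarrow> int) \<Rightarrow> 'e \<Rightarrow> int" where
  "delta G \<phi> e = \<phi> (tail G e) - \<phi> (head G e)"

abbreviation chi :: "('v, 'e) dg \<Rightarrow> 'v set \<Rightarrow> 'e \<Rightarrow> int" where
  "chi G X \<equiv> delta G (\<lambda>v. of_bool (v \<in> X))"

lemma chi_cases: "chi G X e \<in> {-1, 0, 1}"
  by (auto simp: delta_def)

lemma chi_eq_0_iff: "chi G X e = 0 \<longleftrightarrow> (tail G e \<in> X \<longleftrightarrow> head G e \<in> X)"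
  by (auto simp: delta_def)

lemma chi_Compl: "chi G (- X) e = - chi G X e"
  by (auto simp: delta_def)

lemma mem_cut_iff: "e \<in> cut G X \<longleftrightarrow> e \<in> arcs G \<and> chi G X e \<noteq> 0"
  by (auto simp: cut_def chi_eq_0_iff)

lemma delta_add: "delta G (\<lambda>v. \<phi> v + \<psi> v) e = delta G \<phi> e + delta G \<psi> e"
  and delta_diff: "delta G (\<lambda>v. \<phi> v - \<psi> v) e = delta G \<phi> e - delta G \<psi> e"
  and delta_mult: "delta G (\<lambda>v. c * \<phi> v) e = c * delta G \<phi> e"
  by (simp_all add: delta_def algebra_simps)

lemma delta_sum: "delta G (\<lambda>v. \<Sum>i\<in>I. f i v) e = (\<Sum>i\<in>I. delta G (f i) e)"
  by (simp add: delta_def sum_subtractf)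

text \<open>Membership in a set that no arc crosses is constant along undirected walks; conversely,
  the component of a vertex is such a set. Since \<open>X\<close> may contain points outside
  \<open>verts G\<close>, the conclusion is taken relative to \<open>verts G\<close>.\<close>

lemma connected_iff_chi:
  assumes "wf_dg G"
  shows "connected G \<longleftrightarrow>
    (\<forall>X. (\<forall>e\<in>arcs G. chi G X e = 0) \<longrightarrow> verts G \<subseteq> X \<or> verts G \<inter> X = {})"
proof
  assume c: "connected G"
  show "\<forall>X. (\<forall>e\<in>arcs G. chi G X e = 0) \<longrightarrow> verts G \<subseteq> X \<or> verts G \<inter> X = {}"
  proof (intro allI impI)
    fix X assume X: "\<forall>e\<in>arcs G. chi G X e = 0"
    have "u \<in> X \<longleftrightarrow> v \<in> X" if "(u, v) \<in> (undir_rel G)\<^sup>*" for u v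
      using that by induction (use X in \<open>auto simp: undir_rel_def chi_eq_0_iff\<close>)
    then show "verts G \<subseteq> X \<or> verts G \<inter> X = {}"
      using c unfolding connected_def by blast
  qed
next
  assume R: "\<forall>X. (\<forall>e\<in>arcs G. chi G X e = 0) \<longrightarrow> verts G \<subseteq> X \<or> verts G \<inter> X = {}"
  show "connected G"
    unfolding connected_def
  proof (intro ballI)
    fix u v assume uv: "u \<in> verts G" "v \<in> verts G"
    let ?X = "{v. (u, v) \<in> (undir_rel G)\<^sup>*}"
    have "tail G e \<in> ?X \<longleftrightarrow> head G e \<in> ?X" if "e \<in> arcs G" for e
    proof -
      have "(tail G e, head G e) \<in> undir_rel G" "(head G e, tail G e) \<in> undir_rel G"
        using that by (auto simp: undir_rel_def)
      then show ?thesis by (metis mem_Collect_eq rtrancl.rtrancl_into_rtrancl)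
    qed
    then have "\<forall>e\<in>arcs G. chi G ?X e = 0" by (auto simp: delta_def)
    with R have "verts G \<subseteq> ?X \<or> verts G \<inter> ?X = {}" by blast
    then show "(u, v) \<in> (undir_rel G)\<^sup>*" using uv by blast
  qed
qed

lemma wf_dg_arcs_subset: "wf_dg G \<Longrightarrow> T \<subseteq> arcs G \<Longrightarrow> wf_dg (G\<lparr>arcs := T\<rparr>)"
  by (auto simp: wf_dg_def intro: finite_subset)

lemma delta_arcs_update [simp]: "delta (G\<lparr>arcs := T\<rparr>) = delta G"
  by (simp add: delta_def fun_eq_iff)

lemma acyclic_iff_potential:
  assumes wf: "wf_dg G"
  shows "acyclic (arc_rel G) \<longleftrightarrow> (\<exists>\<phi>. \<forall>e\<in>arcs G. delta G \<phi> e > 0)"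
proof
  assume ac: "acyclic (arc_rel G)"
  \<comment> \<open>The potential counts the vertices reachable from \<open>v\<close>. It drops
    strictly along an arc, because without directed cycles the tail is not reachable from the
    head.\<close>
  let ?R = "\<lambda>v. {u \<in> verts G. (v, u) \<in> (arc_rel G)\<^sup>*}"
  have "delta G (\<lambda>v. int (card (?R v))) e > 0" if e: "e \<in> arcs G" for e
  proof -
    have r: "(tail G e, head G e) \<in> arc_rel G" using e by (auto simp: arc_rel_def)
    have "?R (head G e) \<subseteq> ?R (tail G e)"
      using r by (auto intro: converse_rtrancl_into_rtrancl)
    moreover have "tail G e \<in> ?R (tail G e)" using wf e by (auto simp: wf_dg_def)
    moreover have "tail G e \<notin> ?R (head G e)"
    proof
      assume "tail G e \<in> ?R (head G e)"
      then have "(tail G e, tail G e) \<in> (arc_rel G)\<^sup>+"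
        using r by (auto intro: rtrancl_into_trancl2)
      then show False using ac by (auto simp: acyclic_def)
    qed
    ultimately have "?R (head G e) \<subset> ?R (tail G e)" by blast
    moreover have "finite (?R (tail G e))" using wf by (simp add: wf_dg_def)
    ultimately have "card (?R (head G e)) < card (?R (tail G e))" by (rule psubset_card_mono[rotated])
    then show ?thesis by (simp add: delta_def)
  qed
  then show "\<exists>\<phi>. \<forall>e\<in>arcs G. delta G \<phi> e > 0" by blast
next
  assume "\<exists>\<phi>. \<forall>e\<in>arcs G. delta G \<phi> e > 0"
  then obtain \<phi> where \<phi>: "\<forall>e\<in>arcs G. delta G \<phi> e > 0" by blast
  have "\<phi> u > \<phi> v" if "(u, v) \<in> (arc_rel G)\<^sup>+" for u v
    using that by induction (use \<phi> in \<open>fastforce simp: arc_rel_def delta_def\<close>)+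
  then show "acyclic (arc_rel G)" by (fastforce simp: acyclic_def)
qed

text \<open>Acyclicity together with "every directed cut contains \<open>p\<close>": a form of bipolarity that is
  symmetric under cycle-cocycle duality.\<close>

lemma bipolar_iff:
  assumes wf: "wf_dg G"
  shows "bipolar G p \<longleftrightarrow> p \<in> arcs G \<and> connected G \<and> (\<exists>\<phi>. \<forall>e\<in>arcs G. delta G \<phi> e > 0) \<and>
    (\<forall>X. (\<forall>e\<in>arcs G. chi G X e \<ge> 0) \<and> chi G X p = 0 \<longrightarrow> (\<forall>e\<in>arcs G. chi G X e = 0))"
    (is "_ \<longleftrightarrow> ?P \<and> ?C \<and> ?A \<and> ?D")
proof -
  let ?S = "{v. is_source G v} = {tail G p} \<and> {v. is_sink G v} = {head G p}"
  have ends: "tail G e \<in> verts G" "head G e \<in> verts G" if "e \<in> arcs G" for e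
    using wf that by (auto simp: wf_dg_def)
  have "?S \<longleftrightarrow> ?D" if p: ?P and c: ?C and A: ?A
  proof -
    from A obtain \<phi> where "\<forall>e\<in>arcs G. delta G \<phi> e > 0" by blast
    then have \<phi>: "\<phi> (head G e) < \<phi> (tail G e)" if "e \<in> arcs G" for e
      using that by (simp add: delta_def)
    have fin: "finite (verts G)" using wf by (simp add: wf_dg_def)
    \<comment> \<open>In a set closed under predecessors, a vertex of maximal potential is a source
      of the whole digraph. Dually, \<open>sink_in\<close> takes a vertex of minimal
      potential.\<close>
    have source_in: "\<exists>v\<in>X. is_source G v"
      if X: "X \<subseteq> verts G" "X \<noteq> {}" and cl: "\<And>e. e \<in> arcs G \<Longrightarrow> head G e \<in> X \<Longrightarrow> tail G e \<in> X" for X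
    proof -
      have f: "finite (\<phi> ` X)" using fin X finite_subset by blast
      then have "Max (\<phi> ` X) \<in> \<phi> ` X" using X by (intro Max_in) auto
      then obtain v where v: "v \<in> X" "\<phi> v = Max (\<phi> ` X)" by auto
      have "head G e \<noteq> v" if "e \<in> arcs G" for e
        using cl[OF that] \<phi>[OF that] v f by (metis Max_ge imageI not_le)
      then show ?thesis using v X by (auto simp: is_source_def)
    qed
    have sink_in: "\<exists>v\<in>X. is_sink G v"
      if X: "X \<subseteq> verts G" "X \<noteq> {}" and cl: "\<And>e. e \<in> arcs G \<Longrightarrow> tail G e \<in> X \<Longrightarrow> head G e \<in> X" for X
    proof -
      have f: "finite (\<phi> ` X)" using fin X finite_subset by blast
      then have "Min (\<phi> ` X) \<in> \<phi> ` X" using X by (intro Min_in) auto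
      then obtain v where v: "v \<in> X" "\<phi> v = Min (\<phi> ` X)" by auto
      have "tail G e \<noteq> v" if "e \<in> arcs G" for e
        using cl[OF that] \<phi>[OF that] v f by (metis Min_le imageI not_le)
      then show ?thesis using v X by (auto simp: is_sink_def)
    qed
    show ?thesis
    proof
      assume S: ?S
      show ?D
      proof (intro allI impI; elim conjE)
        fix X assume X: "\<forall>e\<in>arcs G. chi G X e \<ge> 0" "chi G X p = 0"
        have dir: "tail G e \<in> X" if "e \<in> arcs G" "head G e \<in> X" for e
          using X(1) that by (force simp: delta_def)
        show "\<forall>e\<in>arcs G. chi G X e = 0"
        proof (rule ccontr)
          assume "\<not> ?thesis"
          then obtain f where f: "f \<in> arcs G" "tail G f \<in> X" "head G f \<notin> X"
            using dir by (auto simp: chi_eq_0_iff)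
          \<comment> \<open>The unique source \<open>tail G p\<close> must lie in \<open>X\<close>
            and the unique sink \<open>head G p\<close> outside it, so \<open>p\<close> crosses the
            cut.\<close>
          have "\<exists>v\<in>X \<inter> verts G. is_source G v"
            using f ends dir by (intro source_in) blast+
          moreover have "\<exists>v\<in>verts G - X. is_sink G v"
            using f ends dir by (intro sink_in) blast+
          ultimately have "tail G p \<in> X" "head G p \<notin> X" using S by (auto simp: set_eq_iff)
          then show False using X(2) by (simp add: chi_eq_0_iff)
        qed
      qed
    next
      assume D: ?D
      \<comment> \<open>An isolated vertex would be the only vertex by connectedness, making
        \<open>p\<close> a loop, which no positive tension allows. Hence the cut around a source or
        a sink is nonempty and contains \<open>p\<close>.\<close>
      have nonisolated: "\<exists>e\<in>arcs G. chi G {v} e \<noteq> 0" if v: "v \<in> verts G" for v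
      proof (rule ccontr)
        assume "\<not> ?thesis"
        then have "verts G \<subseteq> {v}" using c v unfolding connected_iff_chi[OF wf] by blast
        then have "tail G p = head G p" using ends[OF p] by auto
        then show False using \<phi>[OF p] by simp
      qed
      have src: "v = tail G p" if s: "is_source G v" for v
      proof -
        have n: "\<forall>e\<in>arcs G. chi G {v} e \<ge> 0" using s by (auto simp: is_source_def delta_def)
        have "v \<in> verts G" using s by (simp add: is_source_def)
        from nonisolated[OF this] n D have "chi G {v} p \<noteq> 0" by blast
        then show ?thesis using s p by (auto simp: is_source_def delta_def)
      qed
      have snk: "v = head G p" if s: "is_sink G v" for v
      proof -
        have n: "\<forall>e\<in>arcs G. chi G (- {v}) e \<ge> 0" using s by (auto simp: is_sink_def delta_def)
        have "v \<in> verts G" using s by (simp add: is_sink_def)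
        from nonisolated[OF this] n D have "chi G (- {v}) p \<noteq> 0" by (metis chi_Compl neg_equal_0_iff_equal)
        then show ?thesis using s p by (auto simp: is_sink_def delta_def)
      qed
      have "verts G \<noteq> {}" using ends p by blast
      then have "\<exists>v. is_source G v" "\<exists>v. is_sink G v"
        using source_in[of "verts G"] sink_in[of "verts G"] ends by blast+
      then show ?S using src snk by blast
    qed
  qed
  then show ?thesis
    unfolding bipolar_def acyclic_iff_potential[OF wf] by blast
qed

section \<open>Spanning trees and their fundamental cocycles\<close>

text \<open>Spanning trees described by cuts alone: \<open>T\<close> meets every nonempty cut
  (connectedness), and each \<open>b\<close> in \<open>T\<close> is the only tree edge of some cut
  (no cycles). This form passes easily to minors and reversals.\<close>

definition basis :: "('v, 'e) dg \<Rightarrow> 'e set \<Rightarrow> bool" where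
  "basis G T \<longleftrightarrow> T \<subseteq> arcs G \<and>
     (\<forall>X. (\<forall>e\<in>T. chi G X e = 0) \<longrightarrow> (\<forall>e\<in>arcs G. chi G X e = 0)) \<and>
     (\<forall>b\<in>T. \<exists>X. chi G X b = 1 \<and> (\<forall>a\<in>T - {b}. chi G X a = 0))"

text \<open>For a basis, the choice does not affect the resulting signs on the arcs, by
  \<open>entry_eqI\<close>.\<close>

definition side :: "('v, 'e) dg \<Rightarrow> 'e set \<Rightarrow> 'e \<Rightarrow> 'v set" where
  "side G T b = (SOME X. chi G X b = 1 \<and> (\<forall>a\<in>T - {b}. chi G X a = 0))"

text \<open>The sign of \<open>e\<close> in the fundamental cocycle of \<open>b\<close>, oriented such that \<open>b\<close> is positive.\<close>

definition entry :: "('v, 'e) dg \<Rightarrow> 'e set \<Rightarrow> 'e \<Rightarrow> 'e \<Rightarrow> int" where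
  "entry G T b e = chi G (side G T b) e"

lemma entry_cases: "entry G T b e \<in> {-1, 0, 1}"
  unfolding entry_def by (rule chi_cases)

lemma entry_tree:
  assumes "basis G T" "b \<in> T" "a \<in> T"
  shows "entry G T b a = of_bool (a = b)"
proof -
  have "\<exists>X. chi G X b = 1 \<and> (\<forall>a\<in>T - {b}. chi G X a = 0)"
    using assms by (auto simp: basis_def)
  from someI_ex[OF this] show ?thesis
    using assms by (auto simp: entry_def side_def)
qed

text \<open>Level sets of an integer potential reduce it to cuts.\<close>

lemma basis_delta_zero:
  assumes B: "basis G T" and z: "\<And>a. a \<in> T \<Longrightarrow> delta G \<phi> a = 0" and e: "e \<in> arcs G"
  shows "delta G \<phi> e = 0"
proof -
  let ?X = "{v. \<phi> v = \<phi> (tail G e)}"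
  have "\<forall>a\<in>T. chi G ?X a = 0" using z by (auto simp: delta_def)
  with B e have "chi G ?X e = 0" unfolding basis_def by blast
  then show ?thesis by (simp add: delta_def)
qed

text \<open>The fundamental cocycles span all tensions: subtracting the combination with the same
  values on \<open>T\<close> leaves a tension vanishing on \<open>T\<close>, hence on all
  arcs.\<close>

lemma delta_decomposition:
  assumes B: "basis G T" and fin: "finite T" and e: "e \<in> arcs G"
  shows "delta G \<phi> e = (\<Sum>b\<in>T. delta G \<phi> b * entry G T b e)"
proof -
  let ?\<psi> = "\<lambda>v. \<phi> v - (\<Sum>b\<in>T. delta G \<phi> b * of_bool (v \<in> side G T b))"
  have *: "delta G ?\<psi> f = delta G \<phi> f - (\<Sum>b\<in>T. delta G \<phi> b * entry G T b f)" for f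
    by (simp add: delta_diff delta_sum delta_mult entry_def)
  have "delta G ?\<psi> e = 0"
  proof (rule basis_delta_zero[OF B _ e])
    fix a assume a: "a \<in> T"
    have "(\<Sum>b\<in>T. delta G \<phi> b * entry G T b a) = (\<Sum>b\<in>T. if a = b then delta G \<phi> b else 0)"
      using entry_tree[OF B _ a] by (intro sum.cong) auto
    then show "delta G ?\<psi> a = 0" using a fin unfolding * by simp
  qed
  then show ?thesis unfolding * by simp
qed

lemma entry_eqI:
  assumes B: "basis G T" and b: "b \<in> T" and X: "chi G X b = c" "\<And>a. a \<in> T - {b} \<Longrightarrow> chi G X a = 0"
    and e: "e \<in> arcs G"
  shows "chi G X e = c * entry G T b e"
proof -
  let ?\<psi> = "\<lambda>v. of_bool (v \<in> X) - c * of_bool (v \<in> side G T b)"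
  have *: "delta G ?\<psi> f = chi G X f - c * entry G T b f" for f
    by (simp add: delta_diff delta_mult entry_def)
  have "delta G ?\<psi> e = 0"
    by (rule basis_delta_zero[OF B _ e]) (use X entry_tree[OF B b] in \<open>auto simp: *\<close>)
  then show ?thesis unfolding * by simp
qed

text \<open>Such a cut vanishes on \<open>T\<close> except at \<open>b\<close>, so it is a multiple
  of the fundamental cocycle; being nonempty, the factor is a sign.\<close>

lemma fund_cocycle_unique:
  assumes B: "basis G T" and b: "b \<in> T"
    and D: "D = cut G X" "D \<noteq> {}" "D \<subseteq> insert b (arcs G - T)"
  shows "\<exists>c\<in>{-1, 1}. \<forall>e\<in>arcs G. chi G X e = c * entry G T b e"
proof -
  have T: "T \<subseteq> arcs G" using B by (simp add: basis_def)
  have z: "chi G X a = 0" if "a \<in> T - {b}" for a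
    using that D(1,3) T mem_cut_iff[of a G X] by blast
  have eq: "chi G X e = chi G X b * entry G T b e" if "e \<in> arcs G" for e
    using entry_eqI[OF B b refl z that] by simp
  have "chi G X b \<noteq> 0" using D(1,2) eq mem_cut_iff[of _ G X] by force
  then have "chi G X b \<in> {-1, 1}" using chi_cases[of G X b] by simp
  then show ?thesis using eq by blast
qed

lemma fund_cocycle_eq:
  assumes wf: "wf_dg G" and B: "basis G T" and b: "b \<in> T"
  shows "fund_cocycle G T b = {e \<in> arcs G. entry G T b e \<noteq> 0}" (is "_ = ?D")
proof -
  have T: "T \<subseteq> arcs G" using B by (simp add: basis_def)
  \<comment> \<open>\<open>is_cut\<close> asks for a subset of \<open>verts G\<close>; the
    intersection changes no sign because all arcs have their ends there.\<close>
  let ?X = "side G T b \<inter> verts G"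
  have "chi G ?X e = entry G T b e" if "e \<in> arcs G" for e
    using wf that by (auto simp: entry_def delta_def wf_dg_def)
  then have cut: "cut G ?X = ?D" by (auto simp: mem_cut_iff)
  have bD: "b \<in> ?D" using b T entry_tree[OF B b b] by auto
  have sub: "?D \<subseteq> insert b (arcs G - T)" using entry_tree[OF B b] by auto
  have uniq: "D = ?D" if "D \<noteq> {}" "is_cut G D" "D \<subseteq> insert b (arcs G - T)" for D
  proof -
    from that(2) obtain X where X: "D = cut G X" by (auto simp: is_cut_def)
    from fund_cocycle_unique[OF B b X that(1,3)] show ?thesis
      unfolding X by (auto simp: set_eq_iff mem_cut_iff)
  qed
  have "is_cut G ?D" unfolding is_cut_def using cut by blast
  then have "is_cocycle G ?D \<and> ?D \<subseteq> insert b (arcs G - T)"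
    using uniq sub bD unfolding is_cocycle_def by blast
  then show ?thesis
    unfolding fund_cocycle_def
    by (rule the_equality) (use uniq in \<open>auto simp: is_cocycle_def\<close>)
qed

text \<open>Every vertex side that yields the fundamental cocycle induces the signs of
  \<open>entry\<close> up to one global factor, so relative signs do not depend on the side.\<close>

lemma cocyc_sign_iff:
  assumes wf: "wf_dg G" and B: "basis G T" and b: "b \<in> T"
    and f: "f \<in> fund_cocycle G T b"
  shows "cocyc_opposite G (fund_cocycle G T b) b f \<longleftrightarrow> entry G T b f = -1" (is ?opp)
    and "cocyc_same G (fund_cocycle G T b) b f \<longleftrightarrow> entry G T b f = 1" (is ?same)
proof -
  let ?D = "fund_cocycle G T b"
  have D: "?D = {e \<in> arcs G. entry G T b e \<noteq> 0}" by (rule fund_cocycle_eq[OF wf B b])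
  have T: "T \<subseteq> arcs G" using B by (simp add: basis_def)
  have bb: "entry G T b b = 1" using entry_tree[OF B b b] by simp
  have bD: "b \<in> ?D" using b T bb by (auto simp: D)
  have sub: "?D \<subseteq> insert b (arcs G - T)" using entry_tree[OF B b] by (auto simp: D)
  have sgn: "(tail G b \<in> X) = (tail G f \<in> X) \<longleftrightarrow> entry G T b f = 1"
    if X: "cut G X = ?D" for X
  proof -
    obtain c where c: "c \<in> {-1, 1}" "\<forall>e\<in>arcs G. chi G X e = c * entry G T b e"
      using fund_cocycle_unique[OF B b X[symmetric] _ sub] bD by blast
    have "chi G X b = c" "chi G X f = c * entry G T b f" "entry G T b f \<in> {-1, 1}"
      using c bb bD f entry_cases[of G T b f] unfolding D by auto
    then show ?thesis using c(1) by (auto simp: delta_def of_bool_def split: if_splits)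
  qed
  let ?X = "side G T b \<inter> verts G"
  have "chi G ?X e = entry G T b e" if "e \<in> arcs G" for e
    using wf that by (auto simp: entry_def delta_def wf_dg_def)
  then have cut: "cut G ?X = ?D" unfolding D by (auto simp: mem_cut_iff)
  have ex: "\<exists>X\<subseteq>verts G. cut G X = ?D" using cut by blast
  have e: "entry G T b f \<in> {-1, 1}" using f entry_cases[of G T b f] by (auto simp: D)
  show ?same using sgn ex bD f by (auto simp: cocyc_same_def)
  have "entry G T b f = -1 \<longleftrightarrow> entry G T b f \<noteq> 1" using e by auto
  then show ?opp using sgn ex bD f by (auto simp: cocyc_opposite_def)
qed

lemma cocyc_commute:
  "cocyc_opposite G D e f \<longleftrightarrow> cocyc_opposite G D f e"
  "cocyc_same G D e f \<longleftrightarrow> cocyc_same G D f e"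
  by (simp_all add: cocyc_opposite_def cocyc_same_def conj_ac eq_commute[of "tail G e \<in> _"])

section \<open>Cycles as circulations\<close>

text \<open>With its traversal sign, each edge contributes the potential difference of consecutive
  vertices. The sum telescopes around the cycle, the last index wrapping to 0.\<close>

lemma cycle_walk_circulation:
  assumes w: "cycle_walk G es vs"
  defines "c \<equiv> \<lambda>i. if tail G (es ! i) = vs ! i then 1 else -1 :: int"
  shows "(\<Sum>i<length es. c i * delta G \<phi> (es ! i)) = 0"
proof -
  let ?k = "length es"
  let ?s = "\<lambda>i. (i + 1) mod ?k"
  have k: "?k > 0" and ends: "\<And>i. i < ?k \<Longrightarrow> {tail G (es ! i), head G (es ! i)} = {vs ! i, vs ! ?s i}"
    using w by (auto simp: cycle_walk_def)
  have "c i * delta G \<phi> (es ! i) = \<phi> (vs ! i) - \<phi> (vs ! ?s i)" if "i < ?k" for i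
    using ends[OF that] by (auto simp: c_def delta_def doubleton_eq_iff)
  then have "(\<Sum>i<?k. c i * delta G \<phi> (es ! i)) = (\<Sum>i<?k. \<phi> (vs ! i)) - (\<Sum>i<?k. \<phi> (vs ! ?s i))"
    by (simp add: sum_subtractf)
  also have "(\<Sum>i<?k. \<phi> (vs ! ?s i)) = (\<Sum>i<?k. \<phi> (vs ! i))"
  proof -
    obtain n where n: "?k = Suc n" using k by (cases ?k) auto
    have "(\<Sum>i<Suc n. \<phi> (vs ! ((i + 1) mod Suc n))) = (\<Sum>i<n. \<phi> (vs ! (i + 1))) + \<phi> (vs ! 0)"
      by simp
    also have "\<dots> = (\<Sum>i<Suc n. \<phi> (vs ! i))"
      by (simp add: sum.lessThan_Suc_shift del: sum.lessThan_Suc)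
    finally show ?thesis by (simp add: n)
  qed
  finally show ?thesis by simp
qed

lemma cycle_circulation:
  assumes w: "cycle_walk G es vs"
  obtains c :: "'e \<Rightarrow> int"
  where "\<And>i. i < length es \<Longrightarrow> c (es ! i) = (if tail G (es ! i) = vs ! i then 1 else -1)"
    and "\<And>\<phi>. (\<Sum>e\<in>set es. c e * delta G \<phi> e) = 0"
    and "\<And>f. f \<in> set es \<Longrightarrow> c f \<noteq> 0"
proof -
  have d: "distinct es" using w by (simp add: cycle_walk_def)
  have bij: "bij_betw ((!) es) {..<length es} (set es)"
    using d by (rule bij_betw_nth) auto
  let ?inv = "the_inv_into {..<length es} ((!) es)"
  define c where "c e = (if tail G e = vs ! ?inv e then 1 else -1 :: int)" for e
  have c: "c (es ! i) = (if tail G (es ! i) = vs ! i then 1 else -1)" if "i < length es" for i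
    using the_inv_into_f_f[of "(!) es" "{..<length es}" i] bij that
    by (simp add: c_def bij_betw_def)
  have "(\<Sum>e\<in>set es. c e * delta G \<phi> e) = 0" for \<phi>
    using cycle_walk_circulation[OF w, of \<phi>] c
    by (simp add: sum.reindex_bij_betw[OF bij, symmetric])
  moreover have "c f \<noteq> 0" for f by (simp add: c_def)
  ultimately show thesis using c that by blast
qed

text \<open>A fundamental cycle meets a fundamental cocycle in at most two edges, so orthogonality
  determines its support and its signs.\<close>

lemma fund_cycle_circulation:
  assumes B: "basis G T" and finE: "finite (arcs G)" and e: "e \<in> arcs G - T"
    and C: "C \<subseteq> insert e T" "C \<noteq> {}" and nz: "\<And>f. f \<in> C \<Longrightarrow> c f \<noteq> 0"
    and orth: "\<And>\<phi>. (\<Sum>f\<in>C. c f * delta G \<phi> f) = (0::int)"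
  shows "C = insert e {b \<in> T. entry G T b e \<noteq> 0}"
    and "\<And>b. b \<in> C - {e} \<Longrightarrow> c b = - entry G T b e * c e"
proof -
  have T: "T \<subseteq> arcs G" using B by (simp add: basis_def)
  have finC: "finite C" using C T e finE by (meson Diff_iff finite_insert finite_subset)
  have key: "(if b \<in> C then c b else 0) + (if e \<in> C then c e * entry G T b e else 0) = 0"
    if b: "b \<in> T" for b
  proof -
    have "c f * entry G T b f = (if f = b then c b else 0) + (if f = e then c e * entry G T b e else 0)"
      if "f \<in> C" for f
      using C(1) that e b entry_tree[OF B b, of f] by auto
    then have "(\<Sum>f\<in>C. c f * entry G T b f)
        = (\<Sum>f\<in>C. (if f = b then c b else 0) + (if f = e then c e * entry G T b e else 0))"
      by (intro sum.cong) auto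
    moreover have "(\<Sum>f\<in>C. c f * entry G T b f) = 0"
      using orth[of "\<lambda>v. of_bool (v \<in> side G T b)"] by (simp add: entry_def)
    ultimately show ?thesis using finC by (simp add: sum.distrib)
  qed
  have eC: "e \<in> C"
  proof (rule ccontr)
    assume n: "e \<notin> C"
    then obtain b where b: "b \<in> C" "b \<in> T" using C by blast
    show False using key[OF b(2)] n b nz by simp
  qed
  have cb: "c b = - entry G T b e * c e" if "b \<in> T" "b \<in> C" for b
    using key[OF that(1)] that eC by (simp add: mult.commute)
  show "C = insert e {b \<in> T. entry G T b e \<noteq> 0}"
    using key eC nz C(1) by (force split: if_splits)
  show "\<And>b. b \<in> C - {e} \<Longrightarrow> c b = - entry G T b e * c e"
    using cb C(1) by blast
qed

section \<open>From walks to cycles, and spanning trees as bases\<close>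

lemma undir_path:
  assumes "(u, v) \<in> (undir_rel (G\<lparr>arcs := T\<rparr>))\<^sup>*"
  shows "\<exists>es vs. length vs = length es + 1 \<and> vs ! 0 = u \<and> vs ! length es = v \<and> distinct vs \<and>
    set es \<subseteq> T \<and> (\<forall>i<length es. {tail G (es ! i), head G (es ! i)} = {vs ! i, vs ! (i + 1)})"
  using assms
proof (induction rule: rtrancl_induct)
  case base
  show ?case by (intro exI[of _ "[]"] exI[of _ "[u]"]) simp
next
  case (step v w)
  then obtain es vs where p: "length vs = length es + 1" "vs ! 0 = u" "vs ! length es = v"
    "distinct vs" "set es \<subseteq> T"
    "\<forall>i<length es. {tail G (es ! i), head G (es ! i)} = {vs ! i, vs ! (i + 1)}" by blast
  obtain f where f: "f \<in> T" "{tail G f, head G f} = {v, w}"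
    using step.hyps(2) by (auto simp: undir_rel_def)
  show ?case
  proof (cases "w \<in> set vs")
    \<comment> \<open>A vertex that was already visited is reached by cutting the path back to its
      occurrence, so the path stays simple.\<close>
    case True
    then obtain k where k: "k < length vs" "vs ! k = w" by (auto simp: in_set_conv_nth)
    let ?es = "take k es" and ?vs = "take (k + 1) vs"
    have "length ?es = k" "length ?vs = k + 1" using k p(1) by auto
    moreover have "set ?es \<subseteq> T" using p(5) set_take_subset[of k es] by blast
    ultimately show ?thesis
      using k p by (intro exI[of _ ?es] exI[of _ ?vs]) auto
  next
    case False
    then show ?thesis
      using p f by (intro exI[of _ "es @ [f]"] exI[of _ "vs @ [w]"]) (auto simp: nth_append less_Suc_eq)
  qed
qed

lemma cycle_through:
  assumes wf: "wf_dg G" and T: "T \<subseteq> arcs G" and e: "e \<in> arcs G - T"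
    and c: "(tail G e, head G e) \<in> (undir_rel (G\<lparr>arcs := T\<rparr>))\<^sup>*"
  shows "\<exists>C. is_cycle G C \<and> C \<subseteq> insert e T"
proof -
  obtain es vs where p: "length vs = length es + 1" "vs ! 0 = tail G e" "vs ! length es = head G e"
    "distinct vs" "set es \<subseteq> T"
    "\<forall>i<length es. {tail G (es ! i), head G (es ! i)} = {vs ! i, vs ! (i + 1)}"
    using undir_path[OF c] by blast
  let ?es = "es @ [e]"
  \<comment> \<open>A repeated edge would have the same pair of ends at two positions, which is
    impossible on a path with distinct vertices.\<close>
  have "es ! i \<noteq> es ! j" if "i < j" "j < length es" for i j
  proof
    assume "es ! i = es ! j"
    then have "{vs ! i, vs ! (i + 1)} = {vs ! j, vs ! (j + 1)}" using p(6) that by (metis less_trans)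
    then have "vs ! i = vs ! j \<or> vs ! i = vs ! (j + 1)" by (auto simp: doubleton_eq_iff)
    then show False using p(1,4) that by (simp add: nth_eq_iff_index_eq)
  qed
  then have "distinct es" by (metis distinct_conv_nth linorder_neqE_nat)
  then have d: "distinct ?es" using p(5) e by auto
  have ends: "{tail G (?es ! i), head G (?es ! i)} = {vs ! i, vs ! ((i + 1) mod length ?es)}"
    if "i < length ?es" for i
    using that p(1,2,3,6) by (cases "i = length es") (auto simp: nth_append)
  have es: "set ?es \<subseteq> arcs G" using p(5) T e by auto
  have "vs ! i \<in> verts G" if "i < length vs" for i
  proof -
    have i: "i < length ?es" using that p(1) by simp
    then have "?es ! i \<in> arcs G" using es nth_mem by blast
    then have "{tail G (?es ! i), head G (?es ! i)} \<subseteq> verts G" using wf by (simp add: wf_dg_def)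
    then show ?thesis unfolding ends[OF i] by simp
  qed
  then have "set vs \<subseteq> verts G" by (metis in_set_conv_nth subsetI)
  then have "cycle_walk G ?es vs"
    unfolding cycle_walk_def using p(1,4) d es ends by simp
  then show ?thesis
    using p(5) by (intro exI[of _ "set ?es"]) (auto simp: is_cycle_def)
qed

lemma spanning_tree_iff_basis:
  assumes wf: "wf_dg G" and conn: "connected G"
  shows "spanning_tree G T \<longleftrightarrow> basis G T"
proof
  assume st: "spanning_tree G T"
  then have T: "T \<subseteq> arcs G" and c: "connected (G\<lparr>arcs := T\<rparr>)"
    and nc: "\<And>C. is_cycle G C \<Longrightarrow> \<not> C \<subseteq> T" by (auto simp: spanning_tree_def)
  have "\<forall>e\<in>arcs G. chi G X e = 0" if "\<forall>e\<in>T. chi G X e = 0" for X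
  proof -
    have "verts G \<subseteq> X \<or> verts G \<inter> X = {}"
      using c that connected_iff_chi[OF wf_dg_arcs_subset[OF wf T]] by simp
    then show ?thesis using wf unfolding wf_dg_def chi_eq_0_iff by blast
  qed
  moreover have "\<exists>X. chi G X b = 1 \<and> (\<forall>a\<in>T - {b}. chi G X a = 0)" if b: "b \<in> T" for b
  proof -
    let ?R = "undir_rel (G\<lparr>arcs := T - {b}\<rparr>)"
    \<comment> \<open>The component of \<open>tail G b\<close> in \<open>T\<close> without
      \<open>b\<close>. If it contained \<open>head G b\<close>, then \<open>b\<close> would close a
      cycle inside \<open>T\<close>.\<close>
    let ?X = "{v. (tail G b, v) \<in> ?R\<^sup>*}"
    have "head G b \<notin> ?X"
    proof
      assume "head G b \<in> ?X"
      then have "\<exists>C. is_cycle G C \<and> C \<subseteq> insert b (T - {b})"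
        using b T by (intro cycle_through[OF wf]) auto
      then show False using nc b by (auto simp: insert_absorb)
    qed
    then have "chi G ?X b = 1" by (simp add: delta_def)
    moreover have "chi G ?X a = 0" if "a \<in> T - {b}" for a
    proof -
      have "(tail G a, head G a) \<in> ?R" "(head G a, tail G a) \<in> ?R"
        using that by (auto simp: undir_rel_def)
      then have "tail G a \<in> ?X \<longleftrightarrow> head G a \<in> ?X"
        by (metis mem_Collect_eq rtrancl.rtrancl_into_rtrancl)
      then show ?thesis by (simp only: chi_eq_0_iff)
    qed
    ultimately show ?thesis by blast
  qed
  ultimately show "basis G T" using T by (simp add: basis_def)
next
  assume B: "basis G T"
  then have T: "T \<subseteq> arcs G" by (simp add: basis_def)
  have "connected (G\<lparr>arcs := T\<rparr>)"
  proof -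
    have "verts G \<subseteq> X \<or> verts G \<inter> X = {}" if "\<forall>e\<in>T. chi G X e = 0" for X
      using that B conn connected_iff_chi[OF wf] unfolding basis_def by blast
    then show ?thesis using connected_iff_chi[OF wf_dg_arcs_subset[OF wf T]] by simp
  qed
  moreover have "\<not> C \<subseteq> T" if C: "is_cycle G C" for C
  proof
    assume sub: "C \<subseteq> T"
    obtain es vs where w: "cycle_walk G es vs" "set es = C" using C unfolding is_cycle_def by blast
    obtain c where c: "\<And>i. i < length es \<Longrightarrow> c (es ! i) = (if tail G (es ! i) = vs ! i then 1 else -1)"
      "\<And>\<phi>. (\<Sum>e\<in>set es. c e * delta G \<phi> e) = (0::int)" "\<And>f. f \<in> set es \<Longrightarrow> c f \<noteq> 0"
      using cycle_circulation[OF w(1)] by metis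
    \<comment> \<open>Pairing a cycle inside \<open>T\<close> with the fundamental cocycle of one of
      its edges leaves only the nonzero coefficient of that edge, contradicting
      orthogonality.\<close>
    let ?b = "es ! 0"
    have 0: "0 < length es" using w by (simp add: cycle_walk_def)
    then have bC: "?b \<in> set es" by simp
    then have b: "?b \<in> T" using sub w by auto
    have "(\<Sum>e\<in>set es. c e * entry G T ?b e) = (\<Sum>e\<in>set es. if e = ?b then c e else 0)"
      using entry_tree[OF B b] sub w by (intro sum.cong) auto
    then have "c ?b = 0" using c(2)[of "\<lambda>v. of_bool (v \<in> side G T ?b)"] bC by (simp add: entry_def)
    then show False using c(1)[OF 0] by (auto split: if_splits)
  qed
  ultimately show "spanning_tree G T" using T by (auto simp: spanning_tree_def)
qed

lemma fund_cycle_eq: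
  assumes wf: "wf_dg G" and conn: "connected G" and B: "basis G T" and e: "e \<in> arcs G - T"
  shows "is_cycle G (fund_cycle G T e)"
    and "fund_cycle G T e = insert e {b \<in> T. entry G T b e \<noteq> 0}"
proof -
  have finE: "finite (arcs G)" using wf by (simp add: wf_dg_def)
  have T: "T \<subseteq> arcs G" using B by (simp add: basis_def)
  have "connected (G\<lparr>arcs := T\<rparr>)"
    using B unfolding spanning_tree_iff_basis[OF wf conn, symmetric] spanning_tree_def by blast
  moreover have "tail G e \<in> verts G" "head G e \<in> verts G" using e wf by (auto simp: wf_dg_def)
  ultimately have "(tail G e, head G e) \<in> (undir_rel (G\<lparr>arcs := T\<rparr>))\<^sup>*" by (simp add: connected_def)
  from cycle_through[OF wf T e this] obtain C where C: "is_cycle G C" "C \<subseteq> insert e T" by blast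
  have eq: "C = insert e {b \<in> T. entry G T b e \<noteq> 0}" if C: "is_cycle G C" "C \<subseteq> insert e T" for C
  proof -
    obtain es vs where w: "cycle_walk G es vs" "set es = C" using C unfolding is_cycle_def by blast
    obtain c where c: "\<And>i. i < length es \<Longrightarrow> c (es ! i) = (if tail G (es ! i) = vs ! i then 1 else -1)"
      "\<And>\<phi>. (\<Sum>e\<in>set es. c e * delta G \<phi> e) = (0::int)" "\<And>f. f \<in> set es \<Longrightarrow> c f \<noteq> 0"
      using cycle_circulation[OF w(1)] by metis
    have ne: "C \<noteq> {}" using w by (auto simp: cycle_walk_def)
    show ?thesis
      by (rule fund_cycle_circulation(1)[OF B finE e C(2) ne, of c]) (use c(2,3) w(2) in auto)
  qed
  have "fund_cycle G T e = C"
    unfolding fund_cycle_def by (rule the_equality) (use C eq in blast)+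
  then show "is_cycle G (fund_cycle G T e)"
    and "fund_cycle G T e = insert e {b \<in> T. entry G T b e \<noteq> 0}" using C eq by auto
qed

text \<open>Orthogonality makes the cycle coefficient of \<open>b\<close> equal to minus
  \<open>entry G T b e\<close> times that of \<open>e\<close>. This holds for every traversal, so
  the relative sign is well defined.\<close>

lemma cyc_sign_iff:
  assumes wf: "wf_dg G" and conn: "connected G" and B: "basis G T" and e: "e \<in> arcs G - T"
    and b: "b \<in> fund_cycle G T e" "b \<noteq> e"
  shows "cyc_opposite G (fund_cycle G T e) e b \<longleftrightarrow> entry G T b e = 1" (is ?opp)
    and "cyc_same G (fund_cycle G T e) e b \<longleftrightarrow> entry G T b e = -1" (is ?same)
proof -
  let ?C = "fund_cycle G T e"
  have finE: "finite (arcs G)" using wf by (simp add: wf_dg_def)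
  have C: "?C = insert e {b \<in> T. entry G T b e \<noteq> 0}" by (rule fund_cycle_eq(2)[OF wf conn B e])
  have en: "entry G T b e \<in> {-1, 1}" using b C entry_cases[of G T b e] by auto
  have sgn: "(tail G e = vs ! i) = (tail G b = vs ! j) \<longleftrightarrow> entry G T b e = -1"
    if w: "cycle_walk G es vs" "set es = ?C" and ij: "i < length es" "j < length es"
      "es ! i = e" "es ! j = b" for es vs i j
  proof -
    obtain c where c: "\<And>i. i < length es \<Longrightarrow> c (es ! i) = (if tail G (es ! i) = vs ! i then 1 else -1)"
      "\<And>\<phi>. (\<Sum>e\<in>set es. c e * delta G \<phi> e) = (0::int)" "\<And>f. f \<in> set es \<Longrightarrow> c f \<noteq> 0"
      using cycle_circulation[OF w(1)] by metis
    have "c b = - entry G T b e * c e"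
      by (rule fund_cycle_circulation(2)[OF B finE e, of ?C]) (use c(2,3) w(2) b C in auto)
    then show ?thesis using c(1)[OF ij(1)] c(1)[OF ij(2)] ij en by (auto split: if_splits)
  qed
  have ex: "\<exists>es vs i j. cycle_walk G es vs \<and> set es = ?C \<and> i < length es \<and> j < length es \<and>
     es ! i = e \<and> es ! j = b"
  proof -
    obtain es vs where w: "cycle_walk G es vs" "set es = ?C"
      using fund_cycle_eq(1)[OF wf conn B e] by (auto simp: is_cycle_def)
    moreover have "e \<in> set es" "b \<in> set es" using w b C by auto
    ultimately show ?thesis by (metis in_set_conv_nth)
  qed
  show ?same unfolding cyc_same_def using sgn ex by blast
  have "entry G T b e = 1 \<longleftrightarrow> entry G T b e \<noteq> -1" using en by auto
  then show ?opp unfolding cyc_opposite_def using sgn ex by blast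
qed

lemma cyc_commute:
  "cyc_opposite G C e f \<longleftrightarrow> cyc_opposite G C f e"
  "cyc_same G C e f \<longleftrightarrow> cyc_same G C f e"
  by (auto simp: cyc_opposite_def cyc_same_def; metis)+

section \<open>Fully optimal trees\<close>

text \<open>The witness \<open>f\<close> is the minimum of the fundamental cocycle of
  \<open>b\<close>. Phrasing this through \<open>entry\<close> allows a comparison, entry by entry,
  between a digraph, its minors and its reversals.\<close>

definition opt_cocycle :: "('v, 'e::linorder) dg \<Rightarrow> 'e set \<Rightarrow> 'e \<Rightarrow> bool" where
  "opt_cocycle G T b \<longleftrightarrow>
     (\<exists>f\<in>arcs G. f < b \<and> entry G T b f = -1 \<and> (\<forall>g\<in>arcs G. g < f \<longrightarrow> entry G T b g = 0))"

text \<open>In the fundamental cycle of \<open>e\<close>, by orthogonality, \<open>b\<close> and \<open>e\<close> have opposite signs iff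
  \<^term>\<open>entry G T b e = 1\<close>.\<close>

definition opt_cycle :: "('v, 'e::linorder) dg \<Rightarrow> 'e set \<Rightarrow> 'e \<Rightarrow> bool" where
  "opt_cycle G T e \<longleftrightarrow>
     (\<exists>b\<in>T. b < e \<and> entry G T b e = 1 \<and> (\<forall>a\<in>T. a < b \<longrightarrow> entry G T a e = 0))"

definition fully_optimal :: "('v, 'e::linorder) dg \<Rightarrow> 'e set \<Rightarrow> bool" where
  "fully_optimal G T \<longleftrightarrow> basis G T \<and>
     (\<forall>b\<in>T - {Min (arcs G)}. opt_cocycle G T b) \<and> (\<forall>e\<in>arcs G - T. opt_cycle G T e)"

lemma opt_cocycle_iff:
  assumes wf: "wf_dg G" and B: "basis G T" and b: "b \<in> T"
  shows "opt_cocycle G T b \<longleftrightarrow>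
    cocyc_opposite G (fund_cocycle G T b) b (Min (fund_cocycle G T b))"
proof -
  let ?D = "fund_cocycle G T b"
  have T: "T \<subseteq> arcs G" using B by (simp add: basis_def)
  have D: "?D = {e \<in> arcs G. entry G T b e \<noteq> 0}" by (rule fund_cocycle_eq[OF wf B b])
  have bb: "entry G T b b = 1" using entry_tree[OF B b b] by simp
  have bD: "b \<in> ?D" using b T bb by (auto simp: D)
  have fin: "finite ?D" using wf by (auto simp: D wf_dg_def)
  have m: "Min ?D \<in> ?D" using fin bD by (intro Min_in) auto
  have "opt_cocycle G T b \<longleftrightarrow> entry G T b (Min ?D) = -1"
  proof
    assume "opt_cocycle G T b"
    then obtain f where f: "f \<in> arcs G" "entry G T b f = -1" "\<forall>g\<in>arcs G. g < f \<longrightarrow> entry G T b g = 0"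
      by (auto simp: opt_cocycle_def)
    have "Min ?D = f" using fin f by (intro Min_eqI) (auto simp: D not_less[symmetric])
    then show "entry G T b (Min ?D) = -1" using f by simp
  next
    assume e: "entry G T b (Min ?D) = -1"
    then have "Min ?D \<noteq> b" using bb by auto
    moreover have "Min ?D \<le> b" using fin bD by simp
    moreover have "entry G T b g = 0" if "g \<in> arcs G" "g < Min ?D" for g
    proof (rule ccontr)
      assume "entry G T b g \<noteq> 0"
      then have "g \<in> ?D" using that by (simp add: D)
      then show False using fin that(2) Min_le not_le by blast
    qed
    ultimately show "opt_cocycle G T b" using e m unfolding opt_cocycle_def D by force
  qed
  then show ?thesis using cocyc_sign_iff(1)[OF wf B b m] by simp
qed

text \<open>An edge occurs once in a traversal. This settles the case in which an edge is the
  minimum of its own fundamental cycle.\<close>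

lemma not_cyc_opposite_self: "\<not> cyc_opposite G C e e"
  by (auto simp: cyc_opposite_def cycle_walk_def nth_eq_iff_index_eq)

lemma opt_cycle_iff:
  assumes wf: "wf_dg G" and conn: "connected G" and B: "basis G T" and e: "e \<in> arcs G - T"
  shows "opt_cycle G T e \<longleftrightarrow> cyc_opposite G (fund_cycle G T e) e (Min (fund_cycle G T e))"
proof -
  let ?C = "fund_cycle G T e"
  have T: "T \<subseteq> arcs G" using B by (simp add: basis_def)
  have C: "?C = insert e {b \<in> T. entry G T b e \<noteq> 0}" by (rule fund_cycle_eq(2)[OF wf conn B e])
  have fin: "finite ?C" using wf T by (auto simp: C wf_dg_def intro: finite_subset)
  have eC: "e \<in> ?C" by (simp add: C)
  have m: "Min ?C \<in> ?C" using fin eC by (intro Min_in) auto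
  have "opt_cycle G T e \<longleftrightarrow> Min ?C \<noteq> e \<and> entry G T (Min ?C) e = 1"
  proof
    assume "opt_cycle G T e"
    then obtain b where b: "b \<in> T" "b < e" "entry G T b e = 1" "\<forall>a\<in>T. a < b \<longrightarrow> entry G T a e = 0"
      by (auto simp: opt_cycle_def)
    have "Min ?C = b" using fin b by (intro Min_eqI) (auto simp: C not_less[symmetric])
    then show "Min ?C \<noteq> e \<and> entry G T (Min ?C) e = 1" using b by simp
  next
    assume *: "Min ?C \<noteq> e \<and> entry G T (Min ?C) e = 1"
    then have "Min ?C \<in> T" using m C by blast
    moreover have "Min ?C < e" using * fin eC Min_le order.not_eq_order_implies_strict by blast
    moreover have "entry G T a e = 0" if "a \<in> T" "a < Min ?C" for a
    proof (rule ccontr)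
      assume "entry G T a e \<noteq> 0"
      then have "a \<in> ?C" using that by (simp add: C)
      then show False using fin that(2) Min_le not_le by blast
    qed
    ultimately show "opt_cycle G T e" using * unfolding opt_cycle_def by blast
  qed
  then show ?thesis
    using cyc_sign_iff(1)[OF wf conn B e m] by (metis not_cyc_opposite_self)
qed

lemma alpha_eq:
  assumes wf: "wf_dg G" and conn: "connected G"
  shows "alpha G = (THE T. fully_optimal G T)"
proof -
  have "fully_optimal G T \<longleftrightarrow> spanning_tree G T \<and>
     (\<forall>b \<in> T - {Min (arcs G)}. cocyc_opposite G (fund_cocycle G T b) b (Min (fund_cocycle G T b))) \<and>
     (\<forall>e \<in> arcs G - T. cyc_opposite G (fund_cycle G T e) e (Min (fund_cycle G T e)))" for T
    unfolding fully_optimal_def spanning_tree_iff_basis[OF wf conn]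
    using opt_cocycle_iff[OF wf] opt_cycle_iff[OF wf conn] by (metis (no_types, lifting) DiffE)
  then show ?thesis by (simp add: alpha_def)
qed

section \<open>Uniqueness and bipolarity\<close>

text \<open>Powers of two assigned by rank from the top, so that each weight exceeds the sum of the
  weights of all larger edges.\<close>

definition weight :: "'e::linorder set \<Rightarrow> 'e \<Rightarrow> int" where
  "weight E e = 2 ^ card {g \<in> E. e < g}"

lemma weight_pos: "weight E e > 0"
  by (simp add: weight_def)

text \<open>A geometric sum. Inserting a new smallest edge adds the next power of two and leaves the
  other weights unchanged.\<close>

lemma sum_power_card_greater:
  fixes A :: "'e::linorder set"
  assumes "finite A"
  shows "(\<Sum>g\<in>A. weight A g) = 2 ^ card A - 1"
  using assms
proof (induction A rule: finite_linorder_min_induct)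
  case empty
  then show ?case by simp
next
  case (insert b A)
  have "{h \<in> insert b A. b < h} = A" using insert.hyps by auto
  then have 1: "weight (insert b A) b = 2 ^ card A" by (simp add: weight_def)
  have "weight (insert b A) g = weight A g" if "g \<in> A" for g
  proof -
    have "{h \<in> insert b A. g < h} = {h \<in> A. g < h}" using insert.hyps that by auto
    then show ?thesis by (simp add: weight_def)
  qed
  then have "(\<Sum>g\<in>A. weight (insert b A) g) = 2 ^ card A - 1" using insert.IH by simp
  then show ?case using insert.hyps 1 by force
qed

lemma sum_weight_greater:
  assumes "finite E"
  shows "(\<Sum>g\<in>{g \<in> E. m < g}. weight E g) < weight E m"
proof -
  let ?A = "{g \<in> E. m < g}"
  have "weight E g = weight ?A g" if "g \<in> ?A" for g
  proof -
    have "{h \<in> E. g < h} = {h \<in> ?A. g < h}" using that by auto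
    then show ?thesis by (simp add: weight_def)
  qed
  then have "(\<Sum>g\<in>?A. weight E g) = 2 ^ card ?A - 1"
    using sum_power_card_greater[of ?A] assms by simp
  then show ?thesis by (simp add: weight_def)
qed

text \<open>The leading coefficient at \<open>m\<close> is 1 and the later ones are at worst -1. As
  \<open>e\<close> lies above \<open>m\<close> but outside \<open>F\<close>, the weight of
  \<open>m\<close> exceeds that of \<open>e\<close> together with all the later terms.\<close>

lemma weighted_sum_dominates:
  assumes fin: "finite E" and F: "F \<subseteq> E" and m: "m \<in> F" "a m = 1"
    and a: "\<And>g. g \<in> F \<Longrightarrow> a g \<in> {-1, 0, 1}" "\<And>g. g \<in> F \<Longrightarrow> g < m \<Longrightarrow> a g = 0"
    and e: "e \<in> E - F" "m < e"
  shows "(\<Sum>g\<in>F. weight E g * a g) > weight E e"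
proof -
  let ?H = "{g \<in> F. m < g}"
  have finF: "finite F" using fin F finite_subset by blast
  have "(\<Sum>g\<in>F. weight E g * a g) = (\<Sum>g\<in>insert m ?H. weight E g * a g)"
  proof (rule sum.mono_neutral_right)
    show "\<forall>g\<in>F - insert m ?H. weight E g * a g = 0"
      using a(2) by (metis (no_types, lifting) DiffE insertCI linorder_neqE mem_Collect_eq mult_zero_right)
  qed (use finF m in auto)
  also have "\<dots> = weight E m + (\<Sum>g\<in>?H. weight E g * a g)"
    using finF m by simp
  finally have 1: "(\<Sum>g\<in>F. weight E g * a g) = weight E m + (\<Sum>g\<in>?H. weight E g * a g)" .
  have "(\<Sum>g\<in>?H. - weight E g) \<le> (\<Sum>g\<in>?H. weight E g * a g)"
    using a(1) weight_pos[of E] by (intro sum_mono) (force simp: less_imp_le)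
  then have 2: "- (\<Sum>g\<in>?H. weight E g) \<le> (\<Sum>g\<in>?H. weight E g * a g)" by (simp add: sum_negf)
  have "(\<Sum>g\<in>insert e ?H. weight E g) \<le> (\<Sum>g\<in>{g \<in> E. m < g}. weight E g)"
    using fin F e weight_pos[of E] by (intro sum_mono2) (auto simp: less_imp_le)
  then have "weight E e + (\<Sum>g\<in>?H. weight E g) < weight E m"
    using finF e sum_weight_greater[OF fin, of m] by simp
  with 1 2 show ?thesis by linarith
qed

section \<open>Tension and flow certificates of a fully optimal tree\<close>

lemma fully_optimal_Min:
  assumes wf: "wf_dg G" and opt: "fully_optimal G T" and ne: "arcs G \<noteq> {}"
  shows "Min (arcs G) \<in> T"
proof (rule ccontr)
  have fin: "finite (arcs G)" using wf by (simp add: wf_dg_def)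
  assume "Min (arcs G) \<notin> T"
  then have "opt_cycle G T (Min (arcs G))" using opt fin ne by (auto simp: fully_optimal_def)
  then obtain b where "b \<in> T" "b < Min (arcs G)" by (auto simp: opt_cycle_def)
  moreover have "T \<subseteq> arcs G" using opt by (simp add: fully_optimal_def basis_def)
  ultimately show False using fin Min_le not_le by blast
qed

text \<open>The weights decrease so fast that the smallest edge of a fundamental cycle or cocycle
  determines the sign of any weighted sum over it.\<close>

lemma tension_of_fully_optimal:
  assumes wf: "wf_dg G" and opt: "fully_optimal G T"
  obtains \<phi> where "\<And>b. b \<in> T \<Longrightarrow> delta G \<phi> b = weight (arcs G) b"
    and "\<And>e. e \<in> arcs G - T \<Longrightarrow> delta G \<phi> e > weight (arcs G) e"
proof -
  let ?w = "weight (arcs G)"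
  have fin: "finite (arcs G)" using wf by (simp add: wf_dg_def)
  have B: "basis G T" using opt by (simp add: fully_optimal_def)
  then have T: "T \<subseteq> arcs G" by (simp add: basis_def)
  have finT: "finite T" using T fin finite_subset by blast
  let ?\<phi> = "\<lambda>v. \<Sum>b\<in>T. ?w b * of_bool (v \<in> side G T b)"
  have d: "delta G ?\<phi> e = (\<Sum>b\<in>T. ?w b * entry G T b e)" for e
    by (simp add: delta_sum delta_mult entry_def)
  have "delta G ?\<phi> a = ?w a" if a: "a \<in> T" for a
  proof -
    have "(\<Sum>b\<in>T. ?w b * entry G T b a) = (\<Sum>b\<in>T. if a = b then ?w b else 0)"
      using entry_tree[OF B _ a] by (intro sum.cong) auto
    then show ?thesis using a finT unfolding d by simp
  qed
  moreover have "delta G ?\<phi> e > ?w e" if e: "e \<in> arcs G - T" for e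
  proof -
    obtain m where m: "m \<in> T" "m < e" "entry G T m e = 1" "\<forall>a\<in>T. a < m \<longrightarrow> entry G T a e = 0"
      using opt e unfolding fully_optimal_def opt_cycle_def by blast
    show ?thesis unfolding d
      by (rule weighted_sum_dominates[OF fin T, of m]) (use m e entry_cases[of G T] in auto)
  qed
  ultimately show thesis using that by blast
qed

text \<open>The flow is the weighted sum of the fundamental cycles; the lower bounds on
  \<open>T\<close> come from the leading terms of the fundamental cocycles. At the minimal edge no
  optimality condition applies, hence no bound is claimed.\<close>

lemma flow_of_fully_optimal:
  assumes wf: "wf_dg G" and opt: "fully_optimal G T"
  obtains y :: "'e::linorder \<Rightarrow> int"
  where "\<And>e. e \<in> arcs G - T \<Longrightarrow> y e = weight (arcs G) e"
    and "\<And>b. b \<in> T - {Min (arcs G)} \<Longrightarrow> y b > weight (arcs G) b"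
    and "\<And>\<phi>. (\<Sum>e\<in>arcs G. delta G \<phi> e * y e) = 0"
proof -
  let ?E = "arcs G"
  let ?w = "weight ?E"
  have fin: "finite ?E" using wf by (simp add: wf_dg_def)
  have B: "basis G T" using opt by (simp add: fully_optimal_def)
  then have T: "T \<subseteq> ?E" by (simp add: basis_def)
  have finT: "finite T" using T fin finite_subset by blast
  \<comment> \<open>By orthogonality, the fundamental cycle of \<open>g\<close> has coefficient
    \<open>- entry G T e g\<close> at the tree edge \<open>e\<close>.\<close>
  define y where "y e = (if e \<in> T then \<Sum>g\<in>?E - T. ?w g * - entry G T e g else ?w e)" for e
  have "y b > ?w b" if b: "b \<in> T - {Min ?E}" for b
  proof -
    obtain f where f: "f \<in> ?E" "f < b" "entry G T b f = -1" "\<forall>g\<in>?E. g < f \<longrightarrow> entry G T b g = 0"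
      using opt b unfolding fully_optimal_def opt_cocycle_def by blast
    have fT: "f \<notin> T" using f(2,3) b entry_tree[OF B, of b f] by (auto split: if_splits simp: of_bool_def)
    have "(\<Sum>g\<in>?E - T. ?w g * - entry G T b g) > ?w b"
      by (rule weighted_sum_dominates[OF fin, of "?E - T" f "\<lambda>g. - entry G T b g" b])
        (use f fT b T entry_cases[of G T b] in auto)
    then show ?thesis using b by (simp add: y_def)
  qed
  moreover have "(\<Sum>e\<in>?E. delta G \<phi> e * y e) = 0" for \<phi>
  proof -
    have "(\<Sum>e\<in>?E. delta G \<phi> e * y e) = (\<Sum>e\<in>?E - T. delta G \<phi> e * y e) + (\<Sum>b\<in>T. delta G \<phi> b * y b)"
      using sum.subset_diff[OF T fin] by blast
    also have "(\<Sum>b\<in>T. delta G \<phi> b * y b)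
        = (\<Sum>b\<in>T. \<Sum>g\<in>?E - T. - (?w g * (delta G \<phi> b * entry G T b g)))"
      by (intro sum.cong) (auto simp: y_def sum_distrib_left mult_ac)
    \<comment> \<open>After exchanging the sums, the inner one is the expansion of the tension in
      fundamental cocycles, so the tree part cancels the part off the tree.\<close>
    also have "\<dots> = (\<Sum>g\<in>?E - T. - (?w g * (\<Sum>b\<in>T. delta G \<phi> b * entry G T b g)))"
      by (subst sum.swap) (simp add: sum_negf sum_distrib_left)
    also have "\<dots> = (\<Sum>g\<in>?E - T. - (?w g * delta G \<phi> g))"
      by (intro sum.cong) (simp_all add: delta_decomposition[OF B finT, symmetric])
    also have "(\<Sum>e\<in>?E - T. delta G \<phi> e * y e) = (\<Sum>g\<in>?E - T. ?w g * delta G \<phi> g)"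
      by (intro sum.cong) (auto simp: y_def)
    finally show ?thesis by (simp add: sum_negf)
  qed
  ultimately show thesis using that[of y] by (auto simp: y_def)
qed

text \<open>Complementary slackness: both trees are nondegenerate optimal bases of the linear program
  maximizing the weighted sum of a tension \<open>x\<close> subject to \<open>x \<ge> weight\<close>, with equality at the
  smallest edge.\<close>

lemma fully_optimal_subset:
  assumes wf: "wf_dg G" and optT: "fully_optimal G T" and optS: "fully_optimal G S"
  shows "S \<subseteq> T"
proof
  let ?E = "arcs G"
  let ?w = "weight ?E"
  fix e assume eS: "e \<in> S"
  have fin: "finite ?E" using wf by (simp add: wf_dg_def)
  have TS: "T \<subseteq> ?E" "S \<subseteq> ?E" using optT optS by (auto simp: fully_optimal_def basis_def)
  have ne: "?E \<noteq> {}" using eS TS by blast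
  note p = fully_optimal_Min[OF wf optT ne] fully_optimal_Min[OF wf optS ne]
  show "e \<in> T"
  proof (rule ccontr)
    assume eT: "e \<notin> T"
    obtain \<phi> where \<phi>: "\<And>b. b \<in> T \<Longrightarrow> delta G \<phi> b = ?w b" "\<And>e. e \<in> ?E - T \<Longrightarrow> delta G \<phi> e > ?w e"
      using tension_of_fully_optimal[OF wf optT] by blast
    obtain \<psi> where \<psi>: "\<And>b. b \<in> S \<Longrightarrow> delta G \<psi> b = ?w b" "\<And>e. e \<in> ?E - S \<Longrightarrow> delta G \<psi> e > ?w e"
      using tension_of_fully_optimal[OF wf optS] by blast
    obtain y where y: "\<And>e. e \<in> ?E - T \<Longrightarrow> y e = ?w e" "\<And>b. b \<in> T - {Min ?E} \<Longrightarrow> y b > ?w b"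
      "\<And>\<phi>. (\<Sum>e\<in>?E. delta G \<phi> e * y e) = 0"
      using flow_of_fully_optimal[OF wf optT] by blast
    obtain z where z: "\<And>e. e \<in> ?E - S \<Longrightarrow> z e = ?w e" "\<And>b. b \<in> S - {Min ?E} \<Longrightarrow> z b > ?w b"
      "\<And>\<phi>. (\<Sum>e\<in>?E. delta G \<phi> e * z e) = 0"
      using flow_of_fully_optimal[OF wf optS] by blast
    \<comment> \<open>On an edge of exactly one of the trees both factors are nonzero with equal
      sign; on any other edge one factor vanishes. At the minimal edge the two tensions
      agree.\<close>
    let ?t = "\<lambda>e. (delta G \<phi> e - delta G \<psi> e) * (z e - y e)"
    have nonneg: "?t f \<ge> 0" if f: "f \<in> ?E" for f
    proof (cases "f = Min ?E")
      case True
      then show ?thesis using p \<phi>(1) \<psi>(1) by simp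
    next
      case False
      then show ?thesis
        using f \<phi>(1)[of f] \<phi>(2)[of f] \<psi>(1)[of f] \<psi>(2)[of f] y(1)[of f] y(2)[of f] z(1)[of f] z(2)[of f]
        by (cases "f \<in> T"; cases "f \<in> S") (auto simp: mult_nonpos_nonpos)
    qed
    have eE: "e \<in> ?E" using eS TS by blast
    have "e \<noteq> Min ?E" using eT p by blast
    then have pos: "?t e > 0"
      using eS eT eE \<phi>(2)[of e] \<psi>(1)[of e] y(1)[of e] z(2)[of e] by simp
    have "(\<Sum>f\<in>?E. ?t f) = 0"
      using z(3)[of "\<lambda>v. \<phi> v - \<psi> v"] y(3)[of "\<lambda>v. \<phi> v - \<psi> v"]
      by (simp add: delta_diff right_diff_distrib sum_subtractf)
    moreover have "(\<Sum>f\<in>?E. ?t f) > 0"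
      using fin eE pos nonneg by (intro sum_pos2) auto
    ultimately show False by simp
  qed
qed

lemma fully_optimal_unique:
  "wf_dg G \<Longrightarrow> fully_optimal G T \<Longrightarrow> fully_optimal G S \<Longrightarrow> T = S"
  using fully_optimal_subset by (metis subset_antisym)

lemma alpha_eqI:
  "wf_dg G \<Longrightarrow> connected G \<Longrightarrow> fully_optimal G T \<Longrightarrow> alpha G = T"
  unfolding alpha_eq by (rule the_equality) (auto dest: fully_optimal_unique)

text \<open>The positive tension excludes directed cycles. A directed cut avoiding the minimal edge
  pairs to 0 with a flow that is positive on all other edges, so it is empty.\<close>

lemma fully_optimal_bipolar:
  assumes wf: "wf_dg G" and conn: "connected G" and opt: "fully_optimal G T" and ne: "arcs G \<noteq> {}"
  shows "bipolar G (Min (arcs G))"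
proof -
  let ?E = "arcs G"
  have fin: "finite ?E" using wf by (simp add: wf_dg_def)
  obtain \<phi> where \<phi>: "\<And>b. b \<in> T \<Longrightarrow> delta G \<phi> b = weight ?E b" "\<And>e. e \<in> ?E - T \<Longrightarrow> delta G \<phi> e > weight ?E e"
    using tension_of_fully_optimal[OF wf opt] by blast
  have pos: "delta G \<phi> e > 0" if "e \<in> ?E" for e
    using \<phi>(1)[of e] \<phi>(2)[of e] weight_pos[of ?E e] that by (cases "e \<in> T") auto
  obtain y where y: "\<And>e. e \<in> ?E - T \<Longrightarrow> y e = weight ?E e" "\<And>b. b \<in> T - {Min ?E} \<Longrightarrow> y b > weight ?E b"
    "\<And>\<phi>. (\<Sum>e\<in>?E. delta G \<phi> e * y e) = 0"
    using flow_of_fully_optimal[OF wf opt] by blast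
  have ypos: "y e > 0" if "e \<in> ?E" "e \<noteq> Min ?E" for e
    using y(1)[of e] y(2)[of e] weight_pos[of ?E e] that by (cases "e \<in> T") auto
  have "\<forall>e\<in>?E. chi G X e = 0" if X: "\<forall>e\<in>?E. chi G X e \<ge> 0" "chi G X (Min ?E) = 0" for X
  proof -
    have nn: "chi G X e * y e \<ge> 0" if "e \<in> ?E" for e
      using X ypos[of e] that by (cases "e = Min ?E") auto
    then have "\<forall>e\<in>?E. chi G X e * y e = 0"
      using sum_nonneg_eq_0_iff[OF fin nn] y(3)[of "\<lambda>v. of_bool (v \<in> X)"] by simp
    then show ?thesis using X(2) ypos by (metis less_irrefl mult_eq_0_iff)
  qed
  then show ?thesis
    unfolding bipolar_iff[OF wf] using conn pos Min_in[OF fin ne] by blast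
qed

section \<open>Deletion, contraction and reversal of an edge\<close>

definition rev_edge :: "('v, 'e) dg \<Rightarrow> 'e \<Rightarrow> ('v, 'e) dg" where
  "rev_edge G w = G\<lparr>tail := (tail G)(w := head G w), head := (head G)(w := tail G w)\<rparr>"

lemma arcs_minor [simp]:
  "arcs (del_edge G w) = arcs G - {w}"
  "arcs (contr_edge G w) = arcs G - {w}"
  "arcs (rev_edge G w) = arcs G"
  by (simp_all add: del_edge_def contr_edge_def rev_edge_def)

lemma verts_minor [simp]:
  "verts (del_edge G w) = verts G"
  "verts (contr_edge G w) = merge_vtx G w ` verts G"
  "verts (rev_edge G w) = verts G"
  by (simp_all add: del_edge_def contr_edge_def rev_edge_def)

lemma wf_dg_minor:
  assumes "wf_dg G" "w \<in> arcs G"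
  shows "wf_dg (del_edge G w)" "wf_dg (contr_edge G w)" "wf_dg (rev_edge G w)"
  using assms by (auto simp: wf_dg_def del_edge_def contr_edge_def rev_edge_def)

lemma delta_del [simp]: "delta (del_edge G w) = delta G"
  by (simp add: del_edge_def delta_def fun_eq_iff)

lemma delta_contr: "delta (contr_edge G w) \<phi> e = delta G (\<lambda>v. \<phi> (merge_vtx G w v)) e"
  by (simp add: contr_edge_def delta_def)

lemma delta_contr_eq: "delta G \<phi> w = 0 \<Longrightarrow> delta (contr_edge G w) \<phi> e = delta G \<phi> e"
  unfolding delta_contr by (auto simp: delta_def merge_vtx_def)

text \<open>Cuts of the contraction pull back along the merging map to cuts of \<open>G\<close> that
  avoid \<open>w\<close>.\<close>

lemma chi_contr: "chi (contr_edge G w) X e = chi G (merge_vtx G w -` X) e"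
  by (simp add: delta_contr)

lemma chi_vimage_merge_self: "chi G (merge_vtx G w -` X) w = 0"
  by (simp add: delta_def merge_vtx_def)

lemma delta_rev: "delta (rev_edge G w) \<phi> e = (if e = w then - delta G \<phi> e else delta G \<phi> e)"
  by (simp add: rev_edge_def delta_def)

lemma entry_del [simp]: "entry (del_edge G w) = entry G"
  by (simp add: entry_def side_def fun_eq_iff)

text \<open>The second assumption says that \<open>w\<close> is not an isthmus, so deleting it turns
  no nonempty cut into an empty one.\<close>

lemma basis_del_iff:
  assumes "w \<in> arcs G" and "\<And>X. (\<And>e. e \<in> arcs G - {w} \<Longrightarrow> chi G X e = 0) \<Longrightarrow> chi G X w = 0"
  shows "basis (del_edge G w) T \<longleftrightarrow> w \<notin> T \<and> basis G T"
proof -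
  have "(\<forall>e\<in>arcs G - {w}. chi G X e = 0) \<longleftrightarrow> (\<forall>e\<in>arcs G. chi G X e = 0)" for X
    using assms(2)[of X] by blast
  then show ?thesis by (auto simp: basis_def)
qed

lemma basis_contr_iff:
  assumes w: "w \<in> arcs G" "tail G w \<noteq> head G w" and fin: "finite (arcs G)"
  shows "basis (contr_edge G w) T \<longleftrightarrow> w \<notin> T \<and> basis G (insert w T)"
proof
  assume B: "basis (contr_edge G w) T"
  then have T: "T \<subseteq> arcs G - {w}" by (simp add: basis_def)
  have finT: "finite T" using T fin finite_subset by blast
  have zero: "chi G X e = 0" if X: "\<forall>e\<in>insert w T. chi G X e = 0" and e: "e \<in> arcs G" for X e
  proof (cases "e = w")
    case False
    have "\<forall>e\<in>T. chi (contr_edge G w) X e = 0" using X by (simp add: delta_contr_eq)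
    then have "chi (contr_edge G w) X e = 0" using B e False by (simp add: basis_def)
    then show ?thesis using X by (simp add: delta_contr_eq)
  qed (use X in simp)
  have side: "\<exists>X. chi G X b = 1 \<and> (\<forall>a\<in>insert w T - {b}. chi G X a = 0)" if b: "b \<in> T" for b
  proof -
    obtain X where "chi (contr_edge G w) X b = 1" "\<forall>a\<in>T - {b}. chi (contr_edge G w) X a = 0"
      using B b unfolding basis_def by blast
    then show ?thesis using chi_vimage_merge_self[of G w X] unfolding chi_contr by blast
  qed
  have "\<exists>X. chi G X w = 1 \<and> (\<forall>a\<in>insert w T - {w}. chi G X a = 0)"
  proof -
    have "\<forall>b\<in>T. \<exists>X. chi G X b = 1 \<and> (\<forall>a\<in>insert w T - {b}. chi G X a = 0)" using side by blast
    then obtain Y where Y: "\<And>b. b \<in> T \<Longrightarrow> chi G (Y b) b = 1"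
      "\<And>b a. b \<in> T \<Longrightarrow> a \<in> insert w T - {b} \<Longrightarrow> chi G (Y b) a = 0" by metis
    \<comment> \<open>The star of \<open>tail G w\<close> contains \<open>w\<close>, which is no
      loop. Subtracting multiples of the cuts \<open>Y b\<close>, which avoid \<open>w\<close>,
      clears the tension on \<open>T\<close> and keeps its value 1 at \<open>w\<close>.\<close>
    let ?X = "{tail G w}"
    let ?\<psi> = "\<lambda>v. of_bool (v \<in> ?X) - (\<Sum>b\<in>T. chi G ?X b * of_bool (v \<in> Y b))"
    have d: "delta G ?\<psi> f = chi G ?X f - (\<Sum>b\<in>T. chi G ?X b * chi G (Y b) f)" for f
      by (simp only: delta_diff delta_sum delta_mult)
    have dT: "delta G ?\<psi> a = 0" if a: "a \<in> T" for a
    proof -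
      have "(\<Sum>b\<in>T. chi G ?X b * chi G (Y b) a) = (\<Sum>b\<in>T. if a = b then chi G ?X b else 0)"
        using Y a by (intro sum.cong) auto
      then show ?thesis using a finT unfolding d by simp
    qed
    have "(\<Sum>b\<in>T. chi G ?X b * chi G (Y b) w) = 0"
      using Y(2) T by (intro sum.neutral) auto
    moreover have "chi G ?X w = 1" using w(2) by (simp add: delta_def)
    ultimately have dw: "delta G ?\<psi> w = 1" unfolding d by simp
    \<comment> \<open>A level set turns the integer potential back into a cut: the potential drops
      along \<open>w\<close> from the threshold, and is constant along the edges of
      \<open>T\<close>.\<close>
    let ?Z = "{v. ?\<psi> v \<ge> ?\<psi> (tail G w)}"
    have "chi G ?Z w = 1" using dw unfolding delta_def by simp
    moreover have "chi G ?Z a = 0" if "a \<in> T" for a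
      using dT[OF that] unfolding delta_def by simp
    ultimately show ?thesis by blast
  qed
  then show "w \<notin> T \<and> basis G (insert w T)"
    unfolding basis_def using zero side T w by blast
next
  assume *: "w \<notin> T \<and> basis G (insert w T)"
  then have T: "T \<subseteq> arcs G - {w}" by (auto simp: basis_def)
  have "\<forall>e\<in>arcs G - {w}. chi (contr_edge G w) X e = 0" if "\<forall>e\<in>T. chi (contr_edge G w) X e = 0" for X
    using * that chi_vimage_merge_self[of G w X] unfolding chi_contr basis_def by blast
  moreover have "\<exists>X. chi (contr_edge G w) X b = 1 \<and> (\<forall>a\<in>T - {b}. chi (contr_edge G w) X a = 0)"
    if b: "b \<in> T" for b
  proof -
    obtain X where X: "chi G X b = 1" "\<forall>a\<in>insert w T - {b}. chi G X a = 0"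
      using * b unfolding basis_def by blast
    have "chi G X w = 0" using X(2) b * by blast
    then show ?thesis using X by (intro exI[of _ X]) (simp add: delta_contr_eq)
  qed
  ultimately show "basis (contr_edge G w) T" using T by (simp add: basis_def)
qed

lemma entry_contr:
  assumes w: "w \<in> arcs G" "tail G w \<noteq> head G w" and fin: "finite (arcs G)"
    and B: "basis (contr_edge G w) T" and b: "b \<in> T" and e: "e \<in> arcs G - {w}"
  shows "entry (contr_edge G w) T b e = entry G (insert w T) b e"
proof -
  have B': "w \<notin> T" "basis G (insert w T)" using B basis_contr_iff[OF w fin] by auto
  let ?X = "side G (insert w T) b"
  have X: "chi G ?X a = of_bool (a = b)" if "a \<in> insert w T" for a
    using entry_tree[OF B'(2)] b that by (simp add: entry_def)
  have "chi G ?X w = 0" using X[of w] b B'(1) by auto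
  then have eq: "chi (contr_edge G w) ?X = chi G ?X" by (simp add: delta_contr_eq fun_eq_iff)
  have "chi (contr_edge G w) ?X e = 1 * entry (contr_edge G w) T b e"
    by (rule entry_eqI[OF B b]) (use X b e in \<open>auto simp: eq\<close>)
  then show ?thesis by (simp add: eq entry_def)
qed

lemma basis_rev:
  assumes B: "basis G T"
  shows "basis (rev_edge G w) T"
proof -
  have "\<exists>X. chi (rev_edge G w) X b = 1 \<and> (\<forall>a\<in>T - {b}. chi (rev_edge G w) X a = 0)"
    if b: "b \<in> T" for b
  proof -
    obtain X where X: "chi G X b = 1" "\<forall>a\<in>T - {b}. chi G X a = 0"
      using B b unfolding basis_def by blast
    show ?thesis
    proof (cases "b = w")
      case True
      then show ?thesis using X by (intro exI[of _ "- X"]) (unfold delta_rev chi_Compl, simp)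
    next
      case False
      then show ?thesis using X by (intro exI[of _ X]) (simp add: delta_rev)
    qed
  qed
  then show ?thesis using B by (auto simp: basis_def delta_rev)
qed

text \<open>Reversal negates the column of \<open>w\<close>; keeping tree edges positive negates the
  row of \<open>w\<close>. At the diagonal entry the two changes cancel.\<close>

lemma entry_rev:
  assumes B: "basis G T" and b: "b \<in> T" and e: "e \<in> arcs G"
  shows "entry (rev_edge G w) T b e = (if (b = w) = (e = w) then entry G T b e else - entry G T b e)"
proof -
  let ?X = "side G T b"
  have X: "chi G ?X a = of_bool (a = b)" if "a \<in> T" for a
    using entry_tree[OF B b that] by (simp add: entry_def)
  have "chi (rev_edge G w) ?X e = (if b = w then -1 else 1) * entry (rev_edge G w) T b e"
    by (rule entry_eqI[OF basis_rev[OF B] b]) (use X b e in \<open>auto simp: delta_rev\<close>)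
  then show ?thesis by (auto simp: delta_rev entry_def split: if_splits)
qed

section \<open>Bipolarity of minors and reversals\<close>

lemma bipolar_cut_zero:
  assumes "wf_dg G" "bipolar G p" "\<And>e. e \<in> arcs G \<Longrightarrow> chi G X e \<ge> 0" "chi G X p = 0" "e \<in> arcs G"
  shows "chi G X e = 0"
  using assms(2-) unfolding bipolar_iff[OF assms(1)] by blast

text \<open>A cut consisting of \<open>w\<close> alone is directed, up to exchanging its sides, and
  misses \<open>p\<close>.\<close>

lemma bipolar_no_isthmus:
  assumes wf: "wf_dg G" and bip: "bipolar G p" and w: "w \<in> arcs G" "w \<noteq> p"
    and X: "\<And>e. e \<in> arcs G - {w} \<Longrightarrow> chi G X e = 0"
  shows "chi G X w = 0"
proof (cases "chi G X w \<ge> 0")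
  have p: "chi G X p = 0" using X[of p] bip w by (simp add: bipolar_def)
  {
    case True
    show ?thesis
    proof (rule bipolar_cut_zero[OF wf bip _ p w(1)])
      show "chi G X e \<ge> 0" if "e \<in> arcs G" for e using X[of e] True that by (cases "e = w") auto
    qed
  next
    case False
    have "chi G (- X) w = 0"
    proof (rule bipolar_cut_zero[OF wf bip _ _ w(1)])
      show "chi G (- X) e \<ge> 0" if "e \<in> arcs G" for e
        using X[of e] False that unfolding chi_Compl by (cases "e = w") auto
      show "chi G (- X) p = 0" using p unfolding chi_Compl by simp
    qed
    then show ?thesis unfolding chi_Compl by simp
  }
qed

lemma bipolar_no_loop:
  assumes "wf_dg G" "bipolar G p" "e \<in> arcs G"
  shows "tail G e \<noteq> head G e"
proof -
  obtain \<phi> where "delta G \<phi> e > 0" using assms(2,3) unfolding bipolar_iff[OF assms(1)] by blast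
  then show ?thesis by (auto simp: delta_def)
qed

lemma connected_del:
  assumes wf: "wf_dg G" and bip: "bipolar G p" and w: "w \<in> arcs G" "w \<noteq> p"
  shows "connected (del_edge G w)"
proof -
  have "\<forall>e\<in>arcs G. chi G X e = 0" if "\<forall>e\<in>arcs G - {w}. chi G X e = 0" for X
    using bipolar_no_isthmus[OF wf bip w, of X] that by blast
  then show ?thesis
    using bip unfolding bipolar_def connected_iff_chi[OF wf] connected_iff_chi[OF wf_dg_minor(1)[OF wf w(1)]]
    by simp
qed

lemma connected_contr:
  assumes wf: "wf_dg G" and conn: "connected G" and w: "w \<in> arcs G"
  shows "connected (contr_edge G w)"
  unfolding connected_iff_chi[OF wf_dg_minor(2)[OF wf w]] chi_contr
proof (intro allI impI)
  fix X
  let ?Y = "merge_vtx G w -` X"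
  assume "\<forall>e\<in>arcs (contr_edge G w). chi G ?Y e = 0"
  then have "\<forall>e\<in>arcs G. chi G ?Y e = 0" using chi_vimage_merge_self[of G w X] by auto
  then have "verts G \<subseteq> ?Y \<or> verts G \<inter> ?Y = {}" using conn unfolding connected_iff_chi[OF wf] by blast
  then show "verts (contr_edge G w) \<subseteq> X \<or> verts (contr_edge G w) \<inter> X = {}" by auto
qed

lemma connected_rev:
  assumes "wf_dg G" "connected G" "w \<in> arcs G"
  shows "connected (rev_edge G w)"
proof -
  have "chi (rev_edge G w) X e = 0 \<longleftrightarrow> chi G X e = 0" for X e by (simp add: delta_rev)
  then show ?thesis
    using assms connected_iff_chi[OF assms(1)] connected_iff_chi[OF wf_dg_minor(3)[OF assms(1,3)]]
    by simp
qed

text \<open>Directed cuts of the contraction pull back to directed cuts of \<open>G\<close>, so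
  contraction can destroy only acyclicity. A potential that is level on \<open>w\<close> and
  positive elsewhere rules this out.\<close>

lemma bipolar_contrI:
  assumes wf: "wf_dg G" and bip: "bipolar G p" and w: "w \<in> arcs G" "w \<noteq> p"
    and \<phi>: "delta G \<phi> w = 0" "\<And>e. e \<in> arcs G - {w} \<Longrightarrow> delta G \<phi> e > 0"
  shows "bipolar (contr_edge G w) p"
proof -
  have "\<forall>e\<in>arcs (contr_edge G w). chi (contr_edge G w) X e = 0"
    if X: "\<forall>e\<in>arcs (contr_edge G w). chi (contr_edge G w) X e \<ge> 0" "chi (contr_edge G w) X p = 0" for X
  proof -
    have nonneg: "chi G (merge_vtx G w -` X) e \<ge> 0" if "e \<in> arcs G" for e
      using X(1) that chi_vimage_merge_self[of G w X] unfolding chi_contr by (cases "e = w") auto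
    have "chi G (merge_vtx G w -` X) e = 0" if "e \<in> arcs G" for e
      by (rule bipolar_cut_zero[OF wf bip nonneg X(2)[unfolded chi_contr] that])
    then show ?thesis unfolding chi_contr by simp
  qed
  moreover have "\<forall>e\<in>arcs (contr_edge G w). delta (contr_edge G w) \<phi> e > 0"
    using \<phi> by (simp add: delta_contr_eq)
  moreover have "connected (contr_edge G w)" "p \<in> arcs (contr_edge G w)"
    using connected_contr[OF wf _ w(1)] bip w(2) by (auto simp: bipolar_def)
  ultimately show ?thesis unfolding bipolar_iff[OF wf_dg_minor(2)[OF wf w(1)]] by blast
qed

text \<open>Deletion keeps acyclicity. A new directed cut that avoids \<open>p\<close> must come
  from a cut in which \<open>w\<close> is the only backward edge.\<close>

lemma bipolar_delI:
  assumes wf: "wf_dg G" and bip: "bipolar G p" and w: "w \<in> arcs G" "w \<noteq> p"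
    and X: "\<And>X. (\<And>e. e \<in> arcs G - {w} \<Longrightarrow> chi G X e \<ge> 0) \<Longrightarrow> chi G X p = 0 \<Longrightarrow> chi G X w < 0 \<Longrightarrow> False"
  shows "bipolar (del_edge G w) p"
proof -
  have "\<forall>e\<in>arcs G - {w}. chi G X e = 0"
    if X': "\<forall>e\<in>arcs G - {w}. chi G X e \<ge> 0" "chi G X p = 0" for X
  proof -
    have "chi G X w \<ge> 0" using X[of X] X' by force
    then have "chi G X e \<ge> 0" if "e \<in> arcs G" for e using X'(1) that by (cases "e = w") auto
    then show ?thesis using bipolar_cut_zero[OF wf bip _ X'(2)] by blast
  qed
  moreover have "p \<in> arcs G - {w}" "\<exists>\<phi>. \<forall>e\<in>arcs G - {w}. delta G \<phi> e > 0"
    using bip w(2) unfolding bipolar_iff[OF wf] by blast+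
  ultimately show ?thesis
    unfolding bipolar_iff[OF wf_dg_minor(1)[OF wf w(1)]] delta_del arcs_minor
    using connected_del[OF wf bip w] by blast
qed

lemma bipolar_del_or_contr:
  assumes wf: "wf_dg G" and bip: "bipolar G p" and w: "w \<in> arcs G" "w \<noteq> p"
  shows "bipolar (del_edge G w) p \<or> bipolar (contr_edge G w) p"
proof (rule disjCI)
  assume nc: "\<not> bipolar (contr_edge G w) p"
  obtain \<phi> where \<phi>: "\<forall>e\<in>arcs G. delta G \<phi> e > 0" using bip unfolding bipolar_iff[OF wf] by blast
  show "bipolar (del_edge G w) p"
  proof (rule bipolar_delI[OF wf bip w])
    fix X assume X: "\<And>e. e \<in> arcs G - {w} \<Longrightarrow> chi G X e \<ge> 0" "chi G X w < 0"
    \<comment> \<open>In the obstructing cut only \<open>w\<close> is negative. Adding a multiple of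
      it to a positive tension lowers \<open>w\<close> exactly to 0 and decreases no other edge, so
      the contraction would be bipolar.\<close>
    let ?\<psi> = "\<lambda>v. \<phi> v + delta G \<phi> w * of_bool (v \<in> X)"
    have d: "delta G ?\<psi> e = delta G \<phi> e + delta G \<phi> w * chi G X e" for e
      by (simp only: delta_add delta_mult)
    have "chi G X w = -1" using chi_cases[of G X w] X(2) by auto
    then have "delta G ?\<psi> w = 0" unfolding d by simp
    moreover have "delta G ?\<psi> e > 0" if "e \<in> arcs G - {w}" for e
    proof -
      have "delta G \<phi> e > 0" "delta G \<phi> w \<ge> 0" using \<phi> that w(1) by (auto simp: less_imp_le)
      then show ?thesis unfolding d using X(1)[OF that] by (intro add_pos_nonneg mult_nonneg_nonneg)
    qed
    ultimately show False using bipolar_contrI[OF wf bip w] nc by blast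
  qed
qed

text \<open>An obstruction to deletion becomes a directed cut avoiding \<open>p\<close> once
  \<open>w\<close> is reversed. For contraction, positive tensions of the two orientations have
  opposite signs at \<open>w\<close> and can be combined to cancel there.\<close>

lemma bipolar_rev_imp_minors:
  assumes wf: "wf_dg G" and bip: "bipolar G p" and w: "w \<in> arcs G" "w \<noteq> p"
    and rev: "bipolar (rev_edge G w) p"
  shows "bipolar (del_edge G w) p" "bipolar (contr_edge G w) p"
proof -
  let ?R = "rev_edge G w"
  have wfR: "wf_dg ?R" by (rule wf_dg_minor(3)[OF wf w(1)])
  show "bipolar (del_edge G w) p"
  proof (rule bipolar_delI[OF wf bip w])
    fix X assume X: "\<And>e. e \<in> arcs G - {w} \<Longrightarrow> chi G X e \<ge> 0" "chi G X p = 0" "chi G X w < 0"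
    have "chi ?R X w = 0"
      by (rule bipolar_cut_zero[OF wfR rev]) (use X w in \<open>auto simp: delta_rev\<close>)
    then show False using X(3) by (simp add: delta_rev)
  qed
  obtain \<phi> where \<phi>: "\<forall>e\<in>arcs G. delta G \<phi> e > 0"
    using bip unfolding bipolar_iff[OF wf] by blast
  obtain \<psi> where \<psi>: "\<forall>e\<in>arcs G. delta ?R \<psi> e > 0"
    using rev unfolding bipolar_iff[OF wfR] arcs_minor by blast
  let ?a = "delta G \<phi> w" and ?b = "delta ?R \<psi> w"
  let ?\<chi> = "\<lambda>v. ?b * \<phi> v + ?a * \<psi> v"
  have d: "delta G ?\<chi> e = ?b * delta G \<phi> e + ?a * delta G \<psi> e" for e
    by (simp only: delta_add delta_mult)
  show "bipolar (contr_edge G w) p"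
  proof (rule bipolar_contrI[OF wf bip w])
    show "delta G ?\<chi> w = 0" unfolding d by (simp add: delta_rev)
    show "delta G ?\<chi> e > 0" if e: "e \<in> arcs G - {w}" for e
    proof -
      have "delta G \<phi> e > 0" "delta G \<psi> e > 0" "?a > 0" "?b > 0"
        using \<phi> \<psi> e w(1) delta_rev[of G w \<psi> e] by auto
      then show ?thesis unfolding d by (simp add: add_pos_pos)
    qed
  qed
qed

section \<open>Existence and the recursive construction\<close>

text \<open>Full optimality without the condition at the largest edge: the part that is visible in
  the minors.\<close>

definition almost_optimal :: "('v, 'e::linorder) dg \<Rightarrow> 'e set \<Rightarrow> bool" where
  "almost_optimal G T \<longleftrightarrow> basis G T \<and>
     (\<forall>b\<in>T - {Min (arcs G), Max (arcs G)}. opt_cocycle G T b) \<and>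
     (\<forall>e\<in>arcs G - T - {Max (arcs G)}. opt_cycle G T e)"

lemma ex_least_in_finite:
  fixes A :: "'a::linorder set"
  assumes "finite A" "x \<in> A" "P x"
  shows "\<exists>m\<in>A. P m \<and> (\<forall>g\<in>A. g < m \<longrightarrow> \<not> P g)"
proof -
  let ?B = "{x \<in> A. P x}"
  have B: "finite ?B" "?B \<noteq> {}" using assms by auto
  then have "Min ?B \<in> ?B" by (rule Min_in)
  moreover have "\<not> P g" if "g \<in> A" "g < Min ?B" for g
    using Min_le[OF B(1), of g] that by auto
  ultimately show ?thesis by blast
qed

section \<open>Transfer of optimality between a digraph and its minors at the largest edge\<close>

locale bipolar_top =
  fixes G :: "('v, 'e::linorder) dg" and p w :: 'e
  assumes wf: "wf_dg G" and bip: "bipolar G p"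
    and p: "p = Min (arcs G)" and w: "w = Max (arcs G)" and pw: "w \<noteq> p"
begin

lemma fin: "finite (arcs G)"
  using wf by (simp add: wf_dg_def)

lemma p_arc: "p \<in> arcs G"
  using bip by (simp add: bipolar_def)

lemma w_arc: "w \<in> arcs G"
  unfolding w using fin p_arc by (intro Max_in) auto

lemma le_w: "e \<in> arcs G \<Longrightarrow> e \<le> w"
  unfolding w using fin by simp

lemma conn: "connected G"
  using bip by (simp add: bipolar_def)

lemmas wf_minor = wf_dg_minor[OF wf w_arc]

lemma w_noloop: "tail G w \<noteq> head G w"
  by (rule bipolar_no_loop[OF wf bip w_arc])

lemma Min_minor: "Min (arcs G - {w}) = p"
proof (rule Min_eqI)
  show "p \<le> e" if "e \<in> arcs G - {w}" for e using that fin by (simp add: p)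
qed (use fin p_arc pw in auto)

lemma basis_del: "basis (del_edge G w) T \<longleftrightarrow> w \<notin> T \<and> basis G T"
  using basis_del_iff[OF w_arc bipolar_no_isthmus[OF wf bip w_arc pw]] .

lemmas basis_contr = basis_contr_iff[OF w_arc w_noloop fin]

lemma fully_optimal_iff:
  "fully_optimal G T \<longleftrightarrow>
     almost_optimal G T \<and> (if w \<in> T then opt_cocycle G T w else opt_cycle G T w)"
  using pw w_arc unfolding fully_optimal_def almost_optimal_def p[symmetric] w[symmetric] by auto

text \<open>Deciding edges lie strictly below the edge they serve, so \<open>w\<close> is never one
  of them and its removal affects only the condition at \<open>w\<close>.\<close>

lemma fully_optimal_del:
  "fully_optimal (del_edge G w) T \<longleftrightarrow> w \<notin> T \<and> almost_optimal G T"
proof (cases "w \<notin> T \<and> basis G T")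
  case True
  then have T: "T \<subseteq> arcs G - {w}" by (auto simp: basis_def)
  have "opt_cocycle (del_edge G w) T b \<longleftrightarrow> opt_cocycle G T b" if "b \<in> T" for b
  proof -
    have "b \<le> w" using that T le_w by blast
    then show ?thesis by (auto simp: opt_cocycle_def)
  qed
  moreover have "opt_cycle (del_edge G w) T e \<longleftrightarrow> opt_cycle G T e" for e
    by (simp add: opt_cycle_def)
  ultimately show ?thesis
    using True T Min_minor by (auto simp: fully_optimal_def almost_optimal_def basis_del p[symmetric] w[symmetric])
qed (auto simp: fully_optimal_def almost_optimal_def basis_del)

lemma fully_optimal_contr:
  "fully_optimal (contr_edge G w) T \<longleftrightarrow> w \<notin> T \<and> almost_optimal G (insert w T)"
proof (cases "w \<notin> T \<and> basis G (insert w T)")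
  case True
  then have T: "T \<subseteq> arcs G - {w}" by (auto simp: basis_def)
  have B: "basis (contr_edge G w) T" using True basis_contr by blast
  note entry = entry_contr[OF w_arc w_noloop fin B]
  have "opt_cocycle (contr_edge G w) T b \<longleftrightarrow> opt_cocycle G (insert w T) b" if b: "b \<in> T" for b
  proof -
    have "b \<le> w" using that T le_w by blast
    then show ?thesis using entry[OF b] by (auto simp: opt_cocycle_def)
  qed
  moreover have "opt_cycle (contr_edge G w) T e \<longleftrightarrow> opt_cycle G (insert w T) e"
    if e: "e \<in> arcs G - {w}" for e
  proof -
    have "e \<le> w" using e le_w by blast
    then show ?thesis using entry[OF _ e] by (auto simp: opt_cycle_def)
  qed
  ultimately show ?thesis
    using True B T Min_minor pw by (auto simp: fully_optimal_def almost_optimal_def p[symmetric] w[symmetric])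
qed (auto simp: fully_optimal_def almost_optimal_def basis_contr)

text \<open>Reversal changes only entries with exactly one index equal to \<open>w\<close>, whereas
  the conditions away from \<open>w\<close> involve pairs of edges different from
  \<open>w\<close>.\<close>

lemma almost_optimal_rev:
  assumes "almost_optimal G T"
  shows "almost_optimal (rev_edge G w) T"
proof -
  have B: "basis G T" using assms by (simp add: almost_optimal_def)
  then have T: "T \<subseteq> arcs G" by (simp add: basis_def)
  note entry = entry_rev[OF B, of _ _ w]
  have "opt_cocycle (rev_edge G w) T b" if b: "b \<in> T" "b \<noteq> w" "opt_cocycle G T b" for b
  proof -
    obtain f where f: "f \<in> arcs G" "f < b" "entry G T b f = -1" "\<forall>g\<in>arcs G. g < f \<longrightarrow> entry G T b g = 0"
      using b(3) unfolding opt_cocycle_def by blast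
    have "b \<le> w" using b T le_w by blast
    then show ?thesis unfolding opt_cocycle_def
      using f entry[OF b(1)] b(2) by (intro bexI[of _ f]) auto
  qed
  moreover have "opt_cycle (rev_edge G w) T e" if e: "e \<in> arcs G" "e \<noteq> w" "opt_cycle G T e" for e
  proof -
    obtain b where b: "b \<in> T" "b < e" "entry G T b e = 1" "\<forall>a\<in>T. a < b \<longrightarrow> entry G T a e = 0"
      using e(3) unfolding opt_cycle_def by blast
    have "e \<le> w" using e le_w by blast
    then show ?thesis unfolding opt_cycle_def
      using b entry[OF _ e(1)] e(2) by (intro bexI[of _ b]) auto
  qed
  ultimately show ?thesis
    using assms basis_rev[OF B] by (auto simp: almost_optimal_def w)
qed

text \<open>Only the condition at \<open>w\<close> can fail. The least edge of its fundamental cycle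
  or cocycle is not \<open>w\<close>, so failure means the wrong sign there, and reversal flips that
  sign.\<close>

lemma fully_optimal_rev:
  assumes almost: "almost_optimal G T" and nopt: "\<not> fully_optimal G T"
  shows "fully_optimal (rev_edge G w) T"
proof -
  have B: "basis G T" using almost by (simp add: almost_optimal_def)
  then have T: "T \<subseteq> arcs G" by (simp add: basis_def)
  have finT: "finite T" using T fin finite_subset by blast
  note entry = entry_rev[OF B, of _ _ w]
  have R: "almost_optimal (rev_edge G w) T" by (rule almost_optimal_rev[OF almost])
  show ?thesis
  proof (cases "w \<in> T")
    case True
    have ww: "entry G T w w = 1" using entry_tree[OF B True True] by simp
    then have "entry G T w w \<noteq> 0" by simp
    then obtain m where m: "m \<in> arcs G" "entry G T w m \<noteq> 0" "\<And>g. g \<in> arcs G \<Longrightarrow> g < m \<Longrightarrow> entry G T w g = 0"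
      using ex_least_in_finite[OF fin w_arc, of "\<lambda>g. entry G T w g \<noteq> 0"] by blast
    \<comment> \<open>If the largest edge were the least edge of its fundamental cocycle, it would
      be alone in it, hence an isthmus.\<close>
    have "m \<noteq> w"
    proof
      assume eq: "m = w"
      have "chi G (side G T w) e = 0" if "e \<in> arcs G - {w}" for e
        using m(3)[of e] le_w[of e] that by (auto simp: eq entry_def)
      from bipolar_no_isthmus[OF wf bip w_arc pw this] show False using ww by (simp add: entry_def)
    qed
    then have lt: "m < w" using le_w[OF m(1)] by simp
    have "entry G T w m \<noteq> -1"
    proof
      assume "entry G T w m = -1"
      then have "opt_cocycle G T w" unfolding opt_cocycle_def using m(1,3) lt by blast
      then show False using nopt almost True by (simp add: fully_optimal_iff)
    qed
    then have "entry G T w m = 1" using m(2) entry_cases[of G T w m] by simp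
    then have "opt_cocycle (rev_edge G w) T w"
      unfolding opt_cocycle_def using m(1,3) lt entry[OF True]
      by (intro bexI[of _ m]) auto
    then show ?thesis
      using R True unfolding fully_optimal_def almost_optimal_def arcs_minor w[symmetric] by blast
  next
    case False
    \<comment> \<open>A positive tension at \<open>w\<close> expands over the tree edges, so some
      tree edge lies in the fundamental cycle of \<open>w\<close>.\<close>
    obtain \<phi> where "delta G \<phi> w > 0" using bip w_arc unfolding bipolar_iff[OF wf] by blast
    then have "(\<Sum>b\<in>T. delta G \<phi> b * entry G T b w) \<noteq> 0"
      unfolding delta_decomposition[OF B finT w_arc, of \<phi>, symmetric] by simp
    then obtain b where "b \<in> T" "delta G \<phi> b * entry G T b w \<noteq> 0"
      using sum.not_neutral_contains_not_neutral by blast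
    then obtain m where m: "m \<in> T" "entry G T m w \<noteq> 0" "\<And>a. a \<in> T \<Longrightarrow> a < m \<Longrightarrow> entry G T a w = 0"
      using ex_least_in_finite[OF finT, of b "\<lambda>b. entry G T b w \<noteq> 0"] by auto
    have "m \<le> w" using m(1) T le_w by blast
    then have lt: "m < w" using m(1) False by (cases "m = w") auto
    have "entry G T m w \<noteq> 1"
    proof
      assume "entry G T m w = 1"
      then have "opt_cycle G T w" unfolding opt_cycle_def using m(1,3) lt by blast
      then show False using nopt almost False by (simp add: fully_optimal_iff)
    qed
    then have "entry G T m w = -1" using m(2) entry_cases[of G T m w] by simp
    then have "opt_cycle (rev_edge G w) T w"
      unfolding opt_cycle_def using m(1,3) lt entry[OF _ w_arc] False
      by (intro bexI[of _ m]) auto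
    then show ?thesis
      using R False unfolding fully_optimal_def almost_optimal_def arcs_minor w[symmetric] by blast
  qed
qed

text \<open>If \<open>G\<close> has no fully optimal tree, every almost optimal tree becomes fully
  optimal after reversing \<open>w\<close>. The reversed digraph is then bipolar, so both minors are
  bipolar; their trees lift to two trees distinguished by \<open>w\<close>, against
  uniqueness.\<close>

lemma ex_fully_optimal_step:
  assumes del: "bipolar (del_edge G w) p \<Longrightarrow> \<exists>T. fully_optimal (del_edge G w) T"
    and contr: "bipolar (contr_edge G w) p \<Longrightarrow> \<exists>T. fully_optimal (contr_edge G w) T"
  shows "\<exists>T. fully_optimal G T"
proof (rule ccontr)
  assume no: "\<nexists>T. fully_optimal G T"
  let ?R = "rev_edge G w"
  have D: "\<exists>T. w \<notin> T \<and> almost_optimal G T" if "bipolar (del_edge G w) p"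
    using del[OF that] by (simp add: fully_optimal_del)
  have C: "\<exists>T. w \<in> T \<and> almost_optimal G T" if "bipolar (contr_edge G w) p"
    using contr[OF that] unfolding fully_optimal_contr by blast
  have R: "fully_optimal ?R T" if "almost_optimal G T" for T
    using fully_optimal_rev[OF that] no by blast
  obtain T where "almost_optimal G T"
    using bipolar_del_or_contr[OF wf bip w_arc pw] C D by blast
  then have "bipolar ?R p"
    using fully_optimal_bipolar[OF wf_minor(3) connected_rev[OF wf conn w_arc] R] p_arc p by auto
  from bipolar_rev_imp_minors[OF wf bip w_arc pw this] C D obtain T' T''
    where "w \<notin> T'" "almost_optimal G T'" "w \<in> T''" "almost_optimal G T''" by blast
  then show False using fully_optimal_unique[OF wf_minor(3) R R] by blast
qed

end

section \<open>Existence by induction on the number of edges\<close>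

lemma basis_singleton:
  assumes "arcs G = {e}" "tail G e \<noteq> head G e"
  shows "basis G {e}"
proof -
  have "chi G {tail G e} e = 1" using assms by (simp add: delta_def)
  then have "\<exists>X. chi G X e = 1" by (rule exI)
  then show ?thesis using assms(1) by (simp add: basis_def)
qed

lemma fully_optimal_singleton:
  assumes "arcs G = {e}" "tail G e \<noteq> head G e"
  shows "fully_optimal G {e}"
  using basis_singleton[OF assms] by (simp add: fully_optimal_def assms)

lemma ex_fully_optimal:
  assumes "wf_dg G" "bipolar G (Min (arcs G))"
  shows "\<exists>T. fully_optimal G T"
  using assms
proof (induction "card (arcs G)" arbitrary: G rule: less_induct)
  case less
  let ?p = "Min (arcs G)" and ?w = "Max (arcs G)"
  have fin: "finite (arcs G)" using less.prems by (simp add: wf_dg_def)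
  have p: "?p \<in> arcs G" using less.prems by (simp add: bipolar_def)
  show ?case
  proof (cases "?w = ?p")
    case True
    have "e = ?p" if "e \<in> arcs G" for e
      using Min_le[OF fin that] Max_ge[OF fin that] True by auto
    then have "arcs G = {?p}" using p by blast
    from fully_optimal_singleton[OF this bipolar_no_loop[OF less.prems p]] show ?thesis ..
  next
    case False
    interpret bipolar_top G ?p ?w by unfold_locales (use less.prems False in simp_all)
    have c: "card (arcs G - {?w}) < card (arcs G)" using fin w_arc by (rule card_Diff1_less)
    show ?thesis
    proof (rule ex_fully_optimal_step)
      show "\<exists>T. fully_optimal (del_edge G ?w) T" if "bipolar (del_edge G ?w) ?p"
        by (rule less.hyps) (use wf_minor(1) that c Min_minor in simp_all)
      show "\<exists>T. fully_optimal (contr_edge G ?w) T" if "bipolar (contr_edge G ?w) ?p"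
        by (rule less.hyps) (use wf_minor(2) that c Min_minor in simp_all)
    qed
  qed
qed

section \<open>Reading off the fully optimal tree from the minors\<close>

context bipolar_top
begin

lemma alpha_optimal: "fully_optimal G (alpha G)"
proof -
  obtain T where "fully_optimal G T" using ex_fully_optimal[OF wf] bip p by blast
  then show ?thesis using alpha_eqI[OF wf conn] by simp
qed

lemma alpha_del_optimal:
  assumes "bipolar (del_edge G w) p"
  shows "fully_optimal (del_edge G w) (alpha (del_edge G w))"
proof -
  have "bipolar (del_edge G w) (Min (arcs (del_edge G w)))" using assms by (simp add: Min_minor)
  from ex_fully_optimal[OF wf_minor(1) this] obtain T where "fully_optimal (del_edge G w) T" ..
  moreover have "connected (del_edge G w)" using assms by (simp add: bipolar_def)
  ultimately show ?thesis using alpha_eqI[OF wf_minor(1)] by simp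
qed

lemma alpha_contr_optimal:
  assumes "bipolar (contr_edge G w) p"
  shows "fully_optimal (contr_edge G w) (alpha (contr_edge G w))"
proof -
  have "bipolar (contr_edge G w) (Min (arcs (contr_edge G w)))" using assms by (simp add: Min_minor)
  from ex_fully_optimal[OF wf_minor(2) this] obtain T where "fully_optimal (contr_edge G w) T" ..
  moreover have "connected (contr_edge G w)" using assms by (simp add: bipolar_def)
  ultimately show ?thesis using alpha_eqI[OF wf_minor(2)] by simp
qed

text \<open>A fully optimal tree avoiding \<open>w\<close> stays fully optimal after deletion.
  Bipolarity of the deletion is thus a consequence, which settles by exclusion the case where only
  the contraction is bipolar.\<close>

lemma top_notin_alpha:
  assumes "w \<notin> alpha G"
  shows "bipolar (del_edge G w) p" "alpha G = alpha (del_edge G w)"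
proof -
  have opt: "fully_optimal (del_edge G w) (alpha G)"
    using alpha_optimal assms by (simp add: fully_optimal_del fully_optimal_iff)
  have c: "connected (del_edge G w)" by (rule connected_del[OF wf bip w_arc pw])
  show "bipolar (del_edge G w) p"
    using fully_optimal_bipolar[OF wf_minor(1) c opt] p_arc pw unfolding arcs_minor Min_minor by blast
  show "alpha G = alpha (del_edge G w)" using alpha_eqI[OF wf_minor(1) c opt] by simp
qed

lemma top_in_alpha:
  assumes "w \<in> alpha G"
  shows "bipolar (contr_edge G w) p" "alpha G = alpha (contr_edge G w) \<union> {w}"
proof -
  have opt: "fully_optimal (contr_edge G w) (alpha G - {w})"
    using alpha_optimal assms by (simp add: fully_optimal_contr fully_optimal_iff insert_absorb)
  have c: "connected (contr_edge G w)" by (rule connected_contr[OF wf conn w_arc])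
  show "bipolar (contr_edge G w) p"
    using fully_optimal_bipolar[OF wf_minor(2) c opt] p_arc pw unfolding arcs_minor Min_minor by blast
  show "alpha G = alpha (contr_edge G w) \<union> {w}"
    using alpha_eqI[OF wf_minor(2) c opt] assms by auto
qed

text \<open>The tree of the deletion is almost optimal in \<open>G\<close>, so the sign in
  \<open>C\<close> alone decides whether it is fully optimal. If it is not, \<open>w\<close> must
  belong to \<open>alpha G\<close>.\<close>

lemma alpha_by_cycle:
  assumes "bipolar (del_edge G w) p"
  defines "C \<equiv> fund_cycle G (alpha (del_edge G w)) w"
  shows "cyc_opposite G C (Min C) w \<Longrightarrow> alpha G = alpha (del_edge G w)"
    and "cyc_same G C (Min C) w \<Longrightarrow> alpha G = alpha (contr_edge G w) \<union> {w}"
proof -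
  let ?T = "alpha (del_edge G w)"
  have T: "w \<notin> ?T" "almost_optimal G ?T"
    using alpha_del_optimal[OF assms(1)] by (auto simp: fully_optimal_del)
  have B: "basis G ?T" using T by (simp add: almost_optimal_def)
  then have TE: "?T \<subseteq> arcs G" by (simp add: basis_def)
  have e: "w \<in> arcs G - ?T" using w_arc T by blast
  have opt: "fully_optimal G ?T \<longleftrightarrow> cyc_opposite G C w (Min C)"
    using T opt_cycle_iff[OF wf conn B e] by (simp add: fully_optimal_iff C_def)
  show "alpha G = ?T" if "cyc_opposite G C (Min C) w"
    using alpha_eqI[OF wf conn] opt cyc_commute(1)[THEN iffD1, OF that] by blast
  show "alpha G = alpha (contr_edge G w) \<union> {w}" if same: "cyc_same G C (Min C) w"
  proof -
    have C: "C = insert w {b \<in> ?T. entry G ?T b w \<noteq> 0}"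
      unfolding C_def by (rule fund_cycle_eq(2)[OF wf conn B e])
    have "finite C" using TE fin unfolding C by (auto intro: finite_subset)
    then have m: "Min C \<in> C" by (rule Min_in) (simp add: C)
    have "\<not> cyc_opposite G C w (Min C)"
    proof (cases "Min C = w")
      case True
      then show ?thesis by (simp add: not_cyc_opposite_self)
    next
      case False
      note sgn = cyc_sign_iff[OF wf conn B e, folded C_def, OF m False]
      have "cyc_same G C w (Min C)" using same by (rule cyc_commute(2)[THEN iffD1])
      then show ?thesis unfolding sgn by simp
    qed
    then have "\<not> fully_optimal G ?T" using opt by simp
    then have "w \<in> alpha G" using top_notin_alpha(2) alpha_optimal by metis
    then show ?thesis by (rule top_in_alpha)
  qed
qed

text \<open>Dual to \<open>alpha_by_cycle\<close>: the lifted tree of the contraction can fail only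
  at \<open>w\<close>, and failure forces \<open>w\<close> out of \<open>alpha G\<close>.\<close>

lemma alpha_by_cocycle:
  assumes "bipolar (contr_edge G w) p"
  defines "D \<equiv> fund_cocycle G (alpha (contr_edge G w) \<union> {w}) w"
  shows "cocyc_opposite G D (Min D) w \<Longrightarrow> alpha G = alpha (contr_edge G w) \<union> {w}"
    and "cocyc_same G D (Min D) w \<Longrightarrow> alpha G = alpha (del_edge G w)"
proof -
  let ?T = "alpha (contr_edge G w) \<union> {w}"
  have T: "almost_optimal G ?T"
    using alpha_contr_optimal[OF assms(1)] by (simp add: fully_optimal_contr)
  have B: "basis G ?T" using T by (simp add: almost_optimal_def)
  have b: "w \<in> ?T" by simp
  have opt: "fully_optimal G ?T \<longleftrightarrow> cocyc_opposite G D w (Min D)"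
    using T opt_cocycle_iff[OF wf B b] by (simp add: fully_optimal_iff D_def)
  show "alpha G = ?T" if "cocyc_opposite G D (Min D) w"
    using alpha_eqI[OF wf conn] opt cocyc_commute(1)[THEN iffD1, OF that] by blast
  show "alpha G = alpha (del_edge G w)" if same: "cocyc_same G D (Min D) w"
  proof -
    have "Min D \<in> D" using same by (simp add: cocyc_same_def)
    have "\<not> cocyc_opposite G D w (Min D)"
    proof -
      note sgn = cocyc_sign_iff[OF wf B b, folded D_def, OF \<open>Min D \<in> D\<close>]
      have "cocyc_same G D w (Min D)" using same by (rule cocyc_commute(2)[THEN iffD1])
      then show ?thesis unfolding sgn by simp
    qed
    then have "\<not> fully_optimal G ?T" using opt by simp
    then have "w \<notin> alpha G" using top_in_alpha(2) alpha_optimal by metis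
    then show ?thesis by (rule top_notin_alpha)
  qed
qed

end

theorem theorem3p2:
  fixes G :: "('v, 'e::linorder) dg"
  defines "p \<equiv> Min (arcs G)" and "\<omega> \<equiv> Max (arcs G)"
  assumes wf: "wf_dg G" and conn: "connected G" and bip: "bipolar G p"
  shows
    "(card (arcs G) = 1 \<longrightarrow> alpha G = {\<omega>}) \<and>
     (card (arcs G) > 1 \<longrightarrow>
       ((bipolar (contr_edge G \<omega>) p \<and> \<not> bipolar (del_edge G \<omega>) p
           \<longrightarrow> alpha G = alpha (contr_edge G \<omega>) \<union> {\<omega>}) \<and>
        (bipolar (del_edge G \<omega>) p \<and> \<not> bipolar (contr_edge G \<omega>) p
           \<longrightarrow> alpha G = alpha (del_edge G \<omega>)) \<and>
        (bipolar (del_edge G \<omega>) p \<and> bipolar (contr_edge G \<omega>) p \<longrightarrow>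
           (let T' = alpha (del_edge G \<omega>); C = fund_cycle G T' \<omega>; e = Min C in
             (cyc_opposite G C e \<omega> \<longrightarrow> alpha G = alpha (del_edge G \<omega>)) \<and>
             (cyc_same G C e \<omega> \<longrightarrow> alpha G = alpha (contr_edge G \<omega>) \<union> {\<omega>}))) \<and>
        (bipolar (del_edge G \<omega>) p \<and> bipolar (contr_edge G \<omega>) p \<longrightarrow>
           (let T'' = alpha (contr_edge G \<omega>); D = fund_cocycle G (T'' \<union> {\<omega>}) \<omega>; e = Min D in
             (cocyc_opposite G D e \<omega> \<longrightarrow> alpha G = alpha (contr_edge G \<omega>) \<union> {\<omega>}) \<and>
             (cocyc_same G D e \<omega> \<longrightarrow> alpha G = alpha (del_edge G \<omega>))))))"
    (is "?A \<and> (_ \<longrightarrow> ?B)")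
proof
  show ?A
  proof
    assume "card (arcs G) = 1"
    then obtain e where e: "arcs G = {e}" by (auto simp: card_1_singleton_iff)
    have "tail G e \<noteq> head G e" using bipolar_no_loop[OF wf bip] e by simp
    from fully_optimal_singleton[OF e this] show "alpha G = {\<omega>}"
      using alpha_eqI[OF wf conn] e by (simp add: \<omega>_def)
  qed
  show "card (arcs G) > 1 \<longrightarrow> ?B"
  proof
    assume card: "card (arcs G) > 1"
    have "\<omega> \<noteq> p"
    proof
      assume eq: "\<omega> = p"
      have fin: "finite (arcs G)" using wf by (simp add: wf_dg_def)
      have "e = p" if "e \<in> arcs G" for e
        using Min_le[OF fin that] Max_ge[OF fin that] eq by (simp add: p_def \<omega>_def)
      then have "arcs G \<subseteq> {p}" by blast
      then have "card (arcs G) \<le> 1" using card_mono[of "{p}"] by simp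
      then show False using card by simp
    qed
    then interpret bipolar_top G p \<omega>
      by unfold_locales (use wf bip in \<open>simp_all add: p_def \<omega>_def\<close>)
    show ?B
      unfolding Let_def
      \<comment> \<open>When exactly one minor is bipolar, membership of \<open>\<omega>\<close> in
        \<open>alpha G\<close> is decided, since either answer makes the corresponding minor
        bipolar. When both are, the cycle or cocycle sign decides.\<close>
      by (intro conjI impI; (elim conjE)?)
        (use top_in_alpha top_notin_alpha alpha_by_cycle alpha_by_cocycle in metis)+
  qed
qed

end
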